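(* Let $n\ge 1$, $t>0$, and let $A_n=\{a_1,\dots,a_n\}$, $B_n=\{b_1,\dots,b_n\}$ with $-\pi\le a_1<a_2<\cdots<a_n<\pi$ and $-\pi\le b_1<b_2<\cdots<b_n<\pi$ be two sets of $n$ distinct points of the unit circle (points being represented by angles). Let $P(A_n;B_n;t)$ be the transition probability density of $n$ nonintersecting Brownian motions on the unit circle with diffusion parameter $n^{-1/2}$, starting at $A_n$ and ending at $B_n$ after time $t$. Then $$P(A_n;B_n;t)=\det\bigl(P(a_i;b_j;t;\epsilon(n))\bigr)_{i,j=1}^n ,$$ where $$P(a;b;t;\tau)=\sqrt{\frac{n}{2\pi t}}\sum_{k\in\mathbb Z}e^{-\frac{n(b-a+2\pi k)^2}{2t}}e^{2k\pi\tau i},\qquad \epsilon(n)=\begin{cases}0,& n\text{ odd},\\ \tfrac12,& n\text{ even}.\end{cases}$$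
   Context: The unit circle is $\mathbb T=\{e^{i\theta}\}$; a point is represented by its angle $\theta$ modulo $2\pi$. Let $x_k(t)=e^{iB_k(t)/\sqrt n}$, $k=1,\dots,n$, where the $B_k$ are independent standard real Brownian motions. The transition probability density of the nonintersecting Brownian motions is the (sub-probability) density $$P(A_n;B_n;t)=\lim_{\Delta x\to0}\frac{1}{(\Delta x)^n}\,\mathbb P\bigl(\text{the independent particles started at }a_1,\dots,a_n\text{ have pairwise nonintersecting paths on }[0,t]\text{ and at time }t\text{ there is one particle in each arc }[b_j,b_j+\Delta x),\ j=1,\dots,n\bigr).$$ It is not required that the particle started at $a_k$ ends near $b_k$; it may end near any $b_j$. *)

theory Defs
  imports "HOL-Probability.Probability" "Jordan_Normal_Form.Determinant"
begin

text \<open>Standard real Brownian motion on the time axis \<open>[0, \<infinity>)\<close>. Every path is required to be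
  continuous (not only almost every one); this makes the non-intersection event below, which
  involves uncountably many times, measurable.\<close>

definition standard_brownian_motion :: "'w measure \<Rightarrow> (real \<Rightarrow> 'w \<Rightarrow> real) \<Rightarrow> bool" where
  "standard_brownian_motion M B \<longleftrightarrow>
     prob_space M \<and>
     (\<forall>s\<ge>0. B s \<in> borel_measurable M) \<and>
     (AE \<omega> in M. B 0 \<omega> = 0) \<and>
     (\<forall>\<omega>\<in>space M. continuous_on {0..} (\<lambda>s. B s \<omega>)) \<and>
     (\<forall>r s. 0 \<le> r \<and> r < s \<longrightarrow>
        distributed M lborel (\<lambda>\<omega>. B s \<omega> - B r \<omega>) (normal_density 0 (sqrt (s - r)))) \<and>
     (\<forall>(m::nat) (\<tau>::nat \<Rightarrow> real). 0 \<le> \<tau> 0 \<and> strict_mono_on {..m} \<tau> \<longrightarrow>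
        prob_space.indep_vars M (\<lambda>_. borel) (\<lambda>i \<omega>. B (\<tau> (Suc i)) \<omega> - B (\<tau> i) \<omega>) {..<m})"

text \<open>Particles are indexed by \<open>{..<n}\<close>. The processes are independent as random elements of the
  product space of paths, i.e. the \<open>\<sigma>\<close>-algebras they generate are independent.\<close>

definition independent_brownian_motions ::
    "'w measure \<Rightarrow> nat \<Rightarrow> (nat \<Rightarrow> real \<Rightarrow> 'w \<Rightarrow> real) \<Rightarrow> bool" where
  "independent_brownian_motions M n B \<longleftrightarrow>
     (\<forall>k<n. standard_brownian_motion M (B k)) \<and>
     prob_space.indep_vars M (\<lambda>_. PiM {0..} (\<lambda>_. borel))
       (\<lambda>k \<omega>. \<lambda>s\<in>{0..}. B k s \<omega>) {..<n}"

definition particle ::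
    "nat \<Rightarrow> (nat \<Rightarrow> real) \<Rightarrow> (nat \<Rightarrow> real \<Rightarrow> 'w \<Rightarrow> real) \<Rightarrow> nat \<Rightarrow> real \<Rightarrow> 'w \<Rightarrow> complex" where
  "particle n a B k s \<omega> = cis (a k + B k s \<omega> / sqrt (real n))"

definition nonintersecting_event ::
    "'w measure \<Rightarrow> nat \<Rightarrow> (nat \<Rightarrow> real \<Rightarrow> 'w \<Rightarrow> real) \<Rightarrow> (nat \<Rightarrow> real) \<Rightarrow> (nat \<Rightarrow> real)
       \<Rightarrow> real \<Rightarrow> real \<Rightarrow> 'w set" where
  "nonintersecting_event M n B a b t dx =
     {\<omega> \<in> space M.
        (\<forall>s\<in>{0..t}. \<forall>i<n. \<forall>j<n. i \<noteq> j \<longrightarrow> particle n a B i s \<omega> \<noteq> particle n a B j s \<omega>) \<and>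
        (\<forall>j<n. \<exists>!k. k < n \<and> particle n a B k t \<omega> \<in> cis ` {b j..<b j + dx})}"

definition density_quotient ::
    "'w measure \<Rightarrow> nat \<Rightarrow> (nat \<Rightarrow> real \<Rightarrow> 'w \<Rightarrow> real) \<Rightarrow> (nat \<Rightarrow> real) \<Rightarrow> (nat \<Rightarrow> real)
       \<Rightarrow> real \<Rightarrow> real \<Rightarrow> real" where
  "density_quotient M n B a b t dx = measure M (nonintersecting_event M n B a b t dx) / dx ^ n"

text \<open>\<open>Lim\<close> is only meaningful if the limit exists; existence has to be asserted separately.\<close>

definition transition_density ::
    "'w measure \<Rightarrow> nat \<Rightarrow> (nat \<Rightarrow> real \<Rightarrow> 'w \<Rightarrow> real) \<Rightarrow> (nat \<Rightarrow> real) \<Rightarrow> (nat \<Rightarrow> real)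
       \<Rightarrow> real \<Rightarrow> real" where
  "transition_density M n B a b t = Lim (at_right 0) (density_quotient M n B a b t)"

definition circle_kernel :: "nat \<Rightarrow> real \<Rightarrow> real \<Rightarrow> real \<Rightarrow> real \<Rightarrow> complex" where
  "circle_kernel n a b t \<tau> =
     complex_of_real (sqrt (real n / (2 * pi * t))) *
     (\<Sum>\<^sub>\<infinity>k::int. complex_of_real (exp (- (real n * (b - a + 2 * pi * real_of_int k)\<^sup>2 / (2 * t)))) *
                 exp (2 * of_int k * complex_of_real pi * complex_of_real \<tau> * \<i>))"

definition parity_shift :: "nat \<Rightarrow> real" where
  "parity_shift n = (if odd n then 0 else 1 / 2)"

end

theory Submission
  imports Defs
begin

text \<open>
  The proof is a discrete, optional-stopping form of the Karlin--McGregor argument.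
  Put \<open>e = (- 1) ^ (n - 1)\<close> and \<open>F x = det (f\<^sub>j (x\<^sub>i))\<close>, where \<open>f\<^sub>j\<close> is the indicator of the
  arc at \<open>b\<^sub>j\<close>, lifted to the line with the weight \<open>e\<^sup>k\<close> on its \<open>k\<close>-th copy. Expectations of
  \<open>F\<close> are determinants of Gaussian averages of the \<open>f\<^sub>j\<close>; these averages are Lipschitz, so the
  determinant is small when two particles are close modulo \<open>2 \<pi>\<close>, because two rows are then
  almost proportional. Stopping along a dyadic grid at the first time that two particles are
  within \<open>\<delta>\<close> of each other, and letting the mesh and then \<open>\<delta>\<close> tend to zero, shows that paths
  with a collision contribute nothing to the expectation of \<open>F\<close>. Without a collision the
  cyclic order is preserved, and there the weights make \<open>F\<close> equal to the indicator of the event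
  that every arc contains exactly one particle. Dividing by the arc length gives the kernel.
\<close>

section \<open>Signs of permutations and the alcove\<close>

text \<open>The weight \<open>e\<close> is forced by the topology of the circle. Particles that
  never meet keep their cyclic order, but the configuration may wind: moving the lowest lift up by 2
  pi rotates the order of the lifts, and this rotation is an n-cycle of sign (-1)^(n-1). One factor
  \<open>e\<close> per turn cancels the sign, so that every winding class counts with +1; it is also
  the phase in the kernel, whose shift is 0 or 1/2. The arc indicators are discontinuous, so
  \<open>F\<close> need not be small at a near-collision. What is small is its conditional
  expectation given the past, since a Gaussian step over the remaining time makes the indicators
  Lipschitz. The Lipschitz constant explodes as that time shrinks; hence stopping ends at some T <
  t, and T tends to t in a third limit. The terminal instant is settled by exactly proportional
  rows. A threshold and fixed grid times replace the exchange of two paths after a random collision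
  time: independence of finitely many increments suffices, and the error does not grow with the grid
  because the stopping events are disjoint.\<close>

lemma finite_pairs: "finite {(i, j). i < j \<and> j < (n::nat)}"
  by (rule finite_subset[of _ "{..<n} \<times> {..<n}"]) auto

text \<open>A permutation also permutes the two-element index sets; \<open>q\<close> is this action
  on sorted pairs and \<open>r\<close> its inverse. Antisymmetry costs one factor \<open>- 1\<close>
  per inversion.\<close>

lemma prod_pairs_permute:
  fixes h :: "nat \<Rightarrow> nat \<Rightarrow> 'a::comm_ring_1"
  assumes anti: "\<And>i j. h i j = - h j i" and p: "p permutes {..<n}"
  shows "(\<Prod>(i, j) \<in> {(i, j). i < j \<and> j < n}. h (p i) (p j)) =
         (\<Prod>(i, j) \<in> {(i, j). i < j \<and> j < n}. if p i < p j then 1 else - 1) *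
         (\<Prod>(i, j) \<in> {(i, j). i < j \<and> j < n}. h i j)"
proof -
  let ?D = "{(i, j). i < j \<and> j < n}"
  define q where "q = (\<lambda>(i, j). (min (p i) (p j), max (p i) (p j)))"
  define r where "r = (\<lambda>(i, j). (min (inv_into UNIV p i) (inv_into UNIV p j), max (inv_into UNIV p i) (inv_into UNIV p j)))"
  have inj: "p i = p j \<longleftrightarrow> i = j" for i j
    using p by (metis permutes_inj injD)
  have ip: "inv_into UNIV p permutes {..<n}" using p by (rule permutes_inv)
  have invp: "inv_into UNIV p (p i) = i" "p (inv_into UNIV p i) = i" for i
    using permutes_inverses[OF p] by auto
  have iinj: "inv_into UNIV p i = inv_into UNIV p j \<longleftrightarrow> i = j" for i j by (metis invp)
  have lt: "p i < n \<longleftrightarrow> i < n" "inv_into UNIV p i < n \<longleftrightarrow> i < n" for i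
    using permutes_in_image[OF p, of i] permutes_in_image[OF ip, of i] by auto
  have bij: "bij_betw q ?D ?D"
  proof (rule bij_betw_byWitness[where f' = r])
    show "\<forall>a\<in>?D. r (q a) = a" by (auto simp: q_def r_def min_def max_def invp)
    show "\<forall>a\<in>?D. q (r a) = a" by (auto simp: q_def r_def min_def max_def invp)
    show "q ` ?D \<subseteq> ?D"
      by (auto simp: q_def min_def max_def lt) (metis inj le_neq_implies_less less_irrefl)
    show "r ` ?D \<subseteq> ?D"
      by (auto simp: r_def min_def max_def lt) (metis iinj le_neq_implies_less less_irrefl)
  qed
  have "(\<Prod>(i, j) \<in> ?D. h (p i) (p j)) =
        (\<Prod>x\<in>?D. (case x of (i, j) \<Rightarrow> if p i < p j then 1 else - 1) * (case q x of (i, j) \<Rightarrow> h i j))"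
    by (rule prod.cong) (auto simp: q_def min_def max_def anti[symmetric])
  also have "\<dots> = (\<Prod>(i, j) \<in> ?D. if p i < p j then 1 else - 1) * (\<Prod>x\<in>?D. case q x of (i, j) \<Rightarrow> h i j)"
    by (simp add: prod.distrib)
  also have "(\<Prod>x\<in>?D. case q x of (i, j) \<Rightarrow> h i j) = (\<Prod>(i, j) \<in> ?D. h i j)"
    using prod.reindex_bij_betw[OF bij] by simp
  finally show ?thesis .
qed

text \<open>The inversions of a transposition are \<open>(a, b)\<close> and, for every
  \<open>r\<close> strictly between, \<open>(a, r)\<close> and \<open>(r, b)\<close>: an odd
  number.\<close>

lemma prod_pairs_transpose_sign:
  fixes a b n :: nat
  assumes "a < b" "b < n"
  shows "(\<Prod>(i, j) \<in> {(i, j). i < j \<and> j < n}.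
            if Transposition.transpose a b i < Transposition.transpose a b j then 1 else - 1) = (- 1 :: 'a::comm_ring_1)"
proof -
  let ?D = "{(i, j). i < j \<and> j < n}" and ?t = "Transposition.transpose a b"
  let ?I = "insert (a, b) ((\<lambda>r. (a, r)) ` {a<..<b} \<union> (\<lambda>r. (r, b)) ` {a<..<b})"
  have I: "{x \<in> ?D. \<not> (case x of (i, j) \<Rightarrow> ?t i < ?t j)} = ?I"
    using assms by (auto simp: Transposition.transpose_def split: if_splits)
  have "(\<Prod>(i, j) \<in> ?D. if ?t i < ?t j then 1 else - 1 :: 'a) = (\<Prod>x \<in> ?I. - 1)"
    unfolding I[symmetric] by (rule prod.mono_neutral_cong_right) (auto simp: finite_pairs)
  also have "\<dots> = (- 1) ^ card ?I" by simp
  also have "card ?I = Suc (2 * card {a<..<b})"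
  proof -
    have "card ((\<lambda>r. (a, r)) ` {a<..<b} \<union> (\<lambda>r. (r, b)) ` {a<..<b}) = card {a<..<b} + card {a<..<b}"
      by (subst card_Un_disjoint) (auto simp: card_image inj_on_def)
    then show ?thesis by (subst card_insert_disjoint) auto
  qed
  finally show ?thesis by simp
qed

text \<open>The transformation law of the Vandermonde product, for any antisymmetric kernel.
  Induction over transpositions, each of which reverses the sign of both sides.\<close>

lemma prod_pairs_antisym_sign:
  fixes h :: "nat \<Rightarrow> nat \<Rightarrow> 'a::comm_ring_1"
  assumes anti: "\<And>i j. h i j = - h j i" and p: "p permutes {..<n}"
  shows "(\<Prod>(i, j) \<in> {(i, j). i < j \<and> j < n}. h (p i) (p j)) =
         of_int (sign p) * (\<Prod>(i, j) \<in> {(i, j). i < j \<and> j < n}. h i j)"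
  using p
proof (induction rule: permutes_rev_induct[OF finite_lessThan p, case_names id swap])
  case id
  then show ?case by simp
next
  case (swap a b p)
  let ?t = "Transposition.transpose a b"
  have t: "?t permutes {..<n}" using swap by (intro permutes_swap_id) auto
  obtain c d where cd: "c < d" "d < n" "?t = Transposition.transpose c d"
    using swap by (metis lessThan_iff linorder_neqE_nat transpose_commute)
  have "(\<Prod>(i, j) \<in> {(i, j). i < j \<and> j < n}. h ((p \<circ> ?t) i) ((p \<circ> ?t) j)) =
        - (\<Prod>(i, j) \<in> {(i, j). i < j \<and> j < n}. h (p i) (p j))"
    using prod_pairs_permute[of "\<lambda>i j. h (p i) (p j)" ?t n, OF anti t]
    by (simp add: cd(3) prod_pairs_transpose_sign[OF cd(1,2)])
  moreover have "sign (p \<circ> ?t) = - sign p"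
    using swap by (subst sign_compose) (auto simp: sign_swap_id permutation_swap_id dest: permutes_imp_permutation[rotated])
  ultimately show ?case using swap by (simp del: o_apply)
qed


lemma pairs_Suc:
  "{(i, j). i < j \<and> j < Suc n} = {(i, j). i < j \<and> j < n} \<union> (\<lambda>i. (i, n)) ` {..<n}"
  by auto

text \<open>Each index lies in exactly \<open>n - 1\<close> pairs; this is the source of the
  exponent in \<open>e\<close>.\<close>

lemma prod_pairs_mult:
  fixes s :: "nat \<Rightarrow> 'a::comm_ring_1"
  shows "(\<Prod>(i, j) \<in> {(i, j). i < j \<and> j < n}. s i * s j) = (\<Prod>i<n. s i) ^ (n - 1)"
proof (induction n)
  case (Suc n)
  have "(\<Prod>(i, j) \<in> {(i, j). i < j \<and> j < Suc n}. s i * s j) =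
        (\<Prod>(i, j) \<in> {(i, j). i < j \<and> j < n}. s i * s j) * (\<Prod>(i, j) \<in> (\<lambda>i. (i, n)) ` {..<n}. s i * s j)"
    unfolding pairs_Suc by (subst prod.union_disjoint) (auto simp: finite_pairs)
  also have "(\<Prod>(i, j) \<in> (\<lambda>i. (i, n)) ` {..<n}. s i * s j) = (\<Prod>i<n. s i) * s n ^ n"
    by (subst prod.reindex) (auto simp: inj_on_def prod.distrib)
  also have "(\<Prod>(i, j) \<in> {(i, j). i < j \<and> j < n}. s i * s j) * ((\<Prod>i<n. s i) * s n ^ n) = (\<Prod>i<n. s i) ^ n * s n ^ n"
    unfolding Suc.IH by (cases n) (auto simp: mult_ac)
  finally show ?case by (simp add: power_mult_distrib)
qed simp

lemma cos_pi_int: "cos (pi * of_int k) = (- 1) powi k"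
  using cos_int_times_real[of k pi]
  by (cases "even k") (auto simp: cos_integer_2pi power_int_minus_left mult.commute elim!: evenE oddE)

lemma sin_pi_int: "sin (pi * of_int k) = 0"
  by (auto simp: sin_zero_iff_int2 mult.commute)

lemma sin_minus_pi_int: "sin (z - pi * of_int k) = (- 1) powi k * sin z"
  by (simp add: sin_diff cos_pi_int sin_pi_int)

text \<open>An alcove of the affine Weyl group of type A: lifts of \<open>n\<close> distinct points
  of the circle, listed in cyclic order and fitting into one period.\<close>

definition alcove :: "nat \<Rightarrow> (nat \<Rightarrow> real) \<Rightarrow> bool" where
  "alcove n x \<longleftrightarrow> (\<forall>j<n. \<forall>i<j. x i < x j \<and> x j < x i + 2 * pi)"

lemma alcove_prod_sin_pos:
  assumes "alcove n x"
  shows "(\<Prod>(i, j) \<in> {(i, j). i < j \<and> j < n}. sin ((x j - x i) / 2)) > 0"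
proof (rule prod_pos, clarify)
  fix i j assume "i < j" "j < n"
  then show "0 < sin ((x j - x i) / 2)"
    using assms by (intro sin_gt_zero) (auto simp: alcove_def algebra_simps)
qed

text \<open>The product of the \<open>sin ((x\<^sub>j - x\<^sub>i) / 2)\<close> is positive on the alcove. It changes by the sign of a
  permutation of the points, and by \<open>(- 1) ^ (n - 1)\<close> when one point is moved by \<open>2 \<pi>\<close>.\<close>

lemma alcove_sign:
  assumes x: "alcove n x" and y: "alcove n (\<lambda>i. x (p i) - 2 * pi * of_int (k i))"
    and p: "p permutes {..<n}"
  shows "of_int (sign p) * (\<Prod>i<n. ((- 1) ^ (n - 1)) powi k i) = (1::real)"
proof -
  let ?D = "{(i, j). i < j \<and> j < n}"
  define s :: "nat \<Rightarrow> real" where "s i = (- 1) powi k i" for i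
  have s2: "s i = 1 \<or> s i = -1" for i
    by (auto simp: s_def power_int_minus_left)
  have "0 < (\<Prod>(i, j) \<in> ?D. sin ((x (p j) - 2 * pi * of_int (k j) - (x (p i) - 2 * pi * of_int (k i))) / 2))"
    using alcove_prod_sin_pos[OF y] by simp
  also have "\<dots> = (\<Prod>(i, j) \<in> ?D. (s i * s j) * sin ((x (p j) - x (p i)) / 2))"
  proof (rule prod.cong, safe)
    fix i j
    have "(x (p j) - 2 * pi * of_int (k j) - (x (p i) - 2 * pi * of_int (k i))) / 2 =
          (x (p j) - x (p i)) / 2 - pi * of_int (k j - k i)"
      by (simp add: field_simps)
    moreover have "(- 1 :: real) powi (k j - k i) = s i * s j"
      using s2[of i] by (auto simp: power_int_diff s_def field_simps)
    ultimately show "sin ((x (p j) - 2 * pi * of_int (k j) - (x (p i) - 2 * pi * of_int (k i))) / 2) =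
        s i * s j * sin ((x (p j) - x (p i)) / 2)"
      by (simp only: sin_minus_pi_int)
  qed
  also have "\<dots> = (\<Prod>(i, j) \<in> ?D. s i * s j) * (\<Prod>(i, j) \<in> ?D. sin ((x (p j) - x (p i)) / 2))"
    by (simp add: prod.distrib case_prod_unfold)
  also have "(\<Prod>(i, j) \<in> ?D. sin ((x (p j) - x (p i)) / 2)) =
      of_int (sign p) * (\<Prod>(i, j) \<in> ?D. sin ((x j - x i) / 2))"
    by (rule prod_pairs_antisym_sign[OF _ p]) (metis minus_diff_eq minus_divide_left sin_minus)
  also have "(\<Prod>(i, j) \<in> ?D. s i * s j) = (\<Prod>i<n. s i) ^ (n - 1)"
    by (rule prod_pairs_mult)
  finally have "0 < (of_int (sign p) * (\<Prod>i<n. s i) ^ (n - 1)) * (\<Prod>(i, j) \<in> ?D. sin ((x j - x i) / 2))"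
    by (simp add: mult_ac)
  then have "0 < of_int (sign p) * (\<Prod>i<n. s i) ^ (n - 1)"
    using alcove_prod_sin_pos[OF x] zero_less_mult_pos2 by blast
  moreover have "\<bar>of_int (sign p) * (\<Prod>i<n. s i) ^ (n - 1)\<bar> = 1"
    using s2 by (simp add: abs_mult power_abs abs_prod sign_def prod.neutral s_def)
  ultimately have 1: "of_int (sign p) * (\<Prod>i<n. s i) ^ (n - 1) = 1" by simp
  have "((- 1) ^ (n - 1)) powi k i = s i ^ (n - 1)" for i
    unfolding s_def by (simp flip: power_int_power power_int_of_nat power_int_mult add: mult.commute)
  then show ?thesis using 1 by (simp add: prod_power_distrib)
qed

section \<open>Weighted indicators of arcs\<close>

text \<open>Periods are counted from the left end \<open>c\<close> of the arc, so that for
  \<open>d \<le> 2 * pi\<close> no copy of the arc straddles two periods and the weight is constant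
  on each copy.\<close>

definition arc_weight :: "real \<Rightarrow> real \<Rightarrow> real \<Rightarrow> real \<Rightarrow> real" where
  "arc_weight e c d y =
     (let k = \<lfloor>(y - c) / (2 * pi)\<rfloor> in if y - c - 2 * pi * of_int k < d then e powi k else 0)"

lemma arc_weight_eq:
  assumes "c + 2 * pi * of_int k \<le> y" "y < c + 2 * pi * of_int k + 2 * pi"
  shows "arc_weight e c d y = (if y < c + 2 * pi * of_int k + d then e powi k else 0)"
proof -
  have "\<lfloor>(y - c) / (2 * pi)\<rfloor> = k"
    using assms by (intro floor_unique) (auto simp: field_simps)
  then show ?thesis by (auto simp: arc_weight_def)
qed

lemma angle_cell: obtains k :: int where "c + 2 * pi * of_int k \<le> y" "y < c + 2 * pi * of_int k + 2 * pi"
proof -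
  define k where "k = \<lfloor>(y - c) / (2 * pi)\<rfloor>"
  have "of_int k \<le> (y - c) / (2 * pi)" "(y - c) / (2 * pi) < of_int k + 1"
    unfolding k_def by linarith+
  then show ?thesis by (intro that[of k]) (auto simp: field_simps)
qed

text \<open>The quasi-periodicity that makes two rows of the determinant proportional when two
  particles meet on the circle.\<close>

lemma arc_weight_shift:
  assumes "e \<noteq> 0"
  shows "arc_weight e c d (y + 2 * pi * of_int m) = e powi m * arc_weight e c d y"
proof -
  obtain k :: int where "c + 2 * pi * of_int k \<le> y" "y < c + 2 * pi * of_int k + 2 * pi"
    by (rule angle_cell)
  then show ?thesis
    using assms arc_weight_eq[of c k y e d] arc_weight_eq[of c "k + m" "y + 2 * pi * of_int m" e d]
    by (auto simp: power_int_add algebra_simps)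
qed

lemma abs_arc_weight_le: "\<bar>e\<bar> = 1 \<Longrightarrow> \<bar>arc_weight e c d y\<bar> \<le> 1"
  by (auto simp: arc_weight_def Let_def power_int_abs)

lemma arc_weight_nonzeroE:
  assumes "arc_weight e c d y \<noteq> 0"
  obtains k :: int where "c + 2 * pi * of_int k \<le> y" "y < c + 2 * pi * of_int k + d" "arc_weight e c d y = e powi k"
proof -
  obtain k :: int where "c + 2 * pi * of_int k \<le> y" "y < c + 2 * pi * of_int k + 2 * pi"
    by (rule angle_cell)
  with assms show ?thesis
    by (intro that[of k]) (auto simp: arc_weight_eq split: if_splits)
qed

lemma cis_eq_iff: "cis x = cis y \<longleftrightarrow> (\<exists>k::int. x = y + 2 * pi * of_int k)"
proof -
  have "cis x = cis y \<longleftrightarrow> exp (\<i> * of_real x) = exp (\<i> * of_real y)"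
    by (simp add: cis_conv_exp)
  also have "\<dots> \<longleftrightarrow> (\<exists>k::int. \<i> * of_real x = \<i> * of_real y + (of_int (2 * k) * pi) * \<i>)"
    by (rule exp_eq)
  also have "\<dots> \<longleftrightarrow> (\<exists>k::int. x = y + 2 * pi * of_int k)"
    by (intro ex_cong1) (auto simp: complex_eq_iff algebra_simps)
  finally show ?thesis .
qed

text \<open>Only vanishing matters here, so \<open>e\<close> is left open: the determinant uses
  \<open>(- 1) ^ (n - 1)\<close>, the measurability argument uses 1.\<close>

lemma cis_in_arc_iff:
  assumes "e \<noteq> 0" "d \<le> 2 * pi"
  shows "cis y \<in> cis ` {c..<c + d} \<longleftrightarrow> arc_weight e c d y \<noteq> 0"
proof
  assume "cis y \<in> cis ` {c..<c + d}"
  then obtain z and k :: int where "c \<le> z" "z < c + d" "y = z + 2 * pi * of_int k"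
    by (auto simp: cis_eq_iff)
  with assms show "arc_weight e c d y \<noteq> 0" by (subst arc_weight_eq[of c k]) auto
next
  assume "arc_weight e c d y \<noteq> 0"
  then obtain k :: int where "c + 2 * pi * of_int k \<le> y" "y < c + 2 * pi * of_int k + d"
    by (rule arc_weight_nonzeroE)
  then show "cis y \<in> cis ` {c..<c + d}"
    by (intro image_eqI[of _ _ "y - 2 * pi * of_int k"]) (auto simp: cis_eq_iff intro!: exI[of _ k])
qed

text \<open>The two inequalities are the gaps between the arcs on either side of the circle; they
  correspond to the cases \<open>l \<ge> k\<close> and \<open>l < k\<close>.\<close>

lemma arc_weight_disjoint:
  assumes "d \<le> c' - c" "c' - c \<le> 2 * pi - d"
    and "arc_weight e c d y \<noteq> 0" "arc_weight e c' d y \<noteq> 0"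
  shows False
proof -
  obtain k :: int where k: "c + 2 * pi * of_int k \<le> y" "y < c + 2 * pi * of_int k + d"
    using assms(3) by (rule arc_weight_nonzeroE)
  obtain l :: int where l: "c' + 2 * pi * of_int l \<le> y" "y < c' + 2 * pi * of_int l + d"
    using assms(4) by (rule arc_weight_nonzeroE)
  show False
  proof (cases "l \<ge> k")
    case True
    then have "2 * pi * of_int k \<le> 2 * pi * of_int l" by simp
    then show False using k l assms(1,2) by linarith
  next
    case False
    then have "l + 1 \<le> k" by simp
    then have "real_of_int (l + 1) \<le> of_int k" by (simp only: of_int_le_iff)
    then have "2 * pi * of_int (l + 1) \<le> 2 * pi * of_int k" by (intro mult_left_mono) auto
    then show False using k l assms(1,2) by (simp add: algebra_simps)
  qed
qed

text \<open>A particle meets at most one of the disjoint arcs, so at most one Leibniz term survives.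
  It equals 1 by \<open>alcove_sign\<close>, because the particles in their own order and the
  particles sorted by arc, moved back by whole turns, both lie in the alcove.\<close>

lemma det_arc_weight:
  fixes x b :: "nat \<Rightarrow> real" and n :: nat
  defines "e \<equiv> (- 1) ^ (n - 1)"
  assumes x: "alcove n x" and d: "0 < d" "d \<le> 2 * pi"
    and b: "\<And>i j. i < j \<Longrightarrow> j < n \<Longrightarrow> d \<le> b j - b i \<and> b j - b i \<le> 2 * pi - d"
  shows "Determinant.det (Matrix.mat n n (\<lambda>(i, j). arc_weight e (b j) d (x i))) =
    (if \<forall>j<n. \<exists>!k. k < n \<and> cis (x k) \<in> cis ` {b j..<b j + d} then 1 else 0)"
proof -
  let ?A = "Matrix.mat n n (\<lambda>(i, j). arc_weight e (b j) d (x i))"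
  have e: "e \<noteq> 0" by (simp add: e_def)
  define hit where "hit i j \<longleftrightarrow> arc_weight e (b j) d (x i) \<noteq> 0" for i j
  have cis_hit: "cis (x i) \<in> cis ` {b j..<b j + d} \<longleftrightarrow> hit i j" for i j
    unfolding hit_def by (rule cis_in_arc_iff) (use e d in auto)
  have hit_unique: "j = j'" if "hit i j" "hit i j'" "j < n" "j' < n" for i j j'
  proof (cases j j' rule: linorder_cases)
    case less
    with arc_weight_disjoint[of d "b j'" "b j" e "x i"] b[OF less] that show ?thesis
      by (auto simp: hit_def)
  next
    case greater
    with arc_weight_disjoint[of d "b j" "b j'" e "x i"] b[OF greater] that show ?thesis
      by (auto simp: hit_def)
  qed
  \<comment> \<open>Expanded by columns, so that a permutation assigns a particle to every
    arc.\<close>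
  have det: "Determinant.det ?A = (\<Sum>p | p permutes {0..<n}. of_int (sign p) * (\<Prod>j = 0..<n. ?A $$ (p j, j)))"
    by (subst det_col[of _ n]) (simp_all add: atLeast0LessThan)
  show ?thesis
  proof (cases "\<forall>j<n. \<exists>i<n. hit i j")
    case False
    then obtain j where j: "j < n" "\<And>i. i < n \<Longrightarrow> \<not> hit i j" by auto
    have "(\<Prod>j = 0..<n. ?A $$ (p j, j)) = 0" if "p permutes {0..<n}" for p
      using j permutes_in_image[OF that, of j] by (intro prod_zero) (auto simp: hit_def intro!: bexI[of _ j])
    then have "Determinant.det ?A = 0" unfolding det by (intro sum.neutral) auto
    moreover have "\<not> (\<forall>j<n. \<exists>!k. k < n \<and> cis (x k) \<in> cis ` {b j..<b j + d})"
      unfolding cis_hit using j by blast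
    ultimately show ?thesis by simp
  next
    case True
    then obtain p0 where p0: "\<And>j. j < n \<Longrightarrow> p0 j < n \<and> hit (p0 j) j" by metis
    define p where "p j = (if j < n then p0 j else j)" for j
    \<comment> \<open>Distinct arcs need distinct particles, and an injective self-map of
      \<open>{..<n}\<close> is a permutation.\<close>
    have "inj_on p {..<n}"
    proof (rule inj_onI)
      fix j j' assume "j \<in> {..<n}" "j' \<in> {..<n}" "p j = p j'"
      then show "j = j'"
        using p0[of j] p0[of j'] by (intro hit_unique[of "p j"]) (simp_all add: p_def)
    qed
    moreover have "p ` {..<n} \<subseteq> {..<n}" using p0 by (auto simp: p_def)
    ultimately have "bij_betw p {..<n} {..<n}"
      by (metis bij_betw_def endo_inj_surj finite_lessThan)
    then have p: "p permutes {..<n}"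
      by (rule bij_imp_permutes) (auto simp: p_def)
    have hit_p: "i = p j" if "hit i j" "i < n" "j < n" for i j
    proof -
      obtain j' where "j' < n" "i = p j'"
        using permutes_image[OF p] \<open>i < n\<close> by (metis imageE lessThan_iff)
      then show ?thesis using hit_unique[of i j j'] p0[of j'] that by (auto simp: p_def)
    qed
    have "\<exists>k::int. b j + 2 * pi * of_int k \<le> x (p j) \<and> x (p j) < b j + 2 * pi * of_int k + d \<and>
        arc_weight e (b j) d (x (p j)) = e powi k" if "j < n" for j
    proof -
      have "arc_weight e (b j) d (x (p j)) \<noteq> 0" using p0[OF that] that by (simp add: hit_def p_def)
      then show ?thesis by (rule arc_weight_nonzeroE) blast
    qed
    then obtain k :: "nat \<Rightarrow> int" where k: "\<And>j. j < n \<Longrightarrow> b j + 2 * pi * of_int (k j) \<le> x (p j) \<and>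
        x (p j) < b j + 2 * pi * of_int (k j) + d \<and> arc_weight e (b j) d (x (p j)) = e powi k j"
      by metis
    have p': "p permutes {0..<n}" using p by (simp add: atLeast0LessThan)
    have "Determinant.det ?A = (\<Sum>q\<in>{p}. of_int (sign q) * (\<Prod>j = 0..<n. ?A $$ (q j, j)))"
      unfolding det
    proof (rule sum.mono_neutral_right)
      show "\<forall>q\<in>{p. p permutes {0..<n}} - {p}. of_int (sign q) * (\<Prod>j = 0..<n. ?A $$ (q j, j)) = 0"
      proof
        fix q assume "q \<in> {p. p permutes {0..<n}} - {p}"
        then have q: "q permutes {0..<n}" "q \<noteq> p" by auto
        then obtain j where "q j \<noteq> p j" by blast
        then have j: "j < n" "q j \<noteq> p j" using q(1) p' by (metis atLeastLessThan_iff le0 permutes_not_in)+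
        have "q j < n" using permutes_in_image[OF q(1), of j] j by simp
        with j hit_p[of "q j" j] have "\<not> hit (q j) j" by auto
        then have "(\<Prod>j = 0..<n. ?A $$ (q j, j)) = 0"
          using j \<open>q j < n\<close> by (intro prod_zero) (auto simp: hit_def intro!: bexI[of _ j])
        then show "of_int (sign q) * (\<Prod>j = 0..<n. ?A $$ (q j, j)) = 0" by simp
      qed
    qed (use p' in \<open>auto simp: finite_permutations\<close>)
    also have "\<dots> = of_int (sign p) * (\<Prod>j<n. e powi k j)"
      using p0 k by (auto simp: p_def atLeast0LessThan intro!: prod.cong)
    also have "\<dots> = 1"
      unfolding e_def
    proof (rule alcove_sign[OF x _ p], unfold alcove_def, intro allI impI)
      \<comment> \<open>Moved back by \<open>k j\<close> turns, particle \<open>p j\<close> lies in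
        \<open>{b j..<b j + d}\<close>; the gap hypotheses on \<open>b\<close> then order the
        particles within one period.\<close>
      fix i j assume ij: "j < n" "i < j"
      show "x (p i) - 2 * pi * of_int (k i) < x (p j) - 2 * pi * of_int (k j) \<and>
        x (p j) - 2 * pi * of_int (k j) < x (p i) - 2 * pi * of_int (k i) + 2 * pi"
        using k[of i] k[of j] b[of i j] ij by auto
    qed
    finally have "Determinant.det ?A = 1" .
    moreover have "\<forall>j<n. \<exists>!k. k < n \<and> cis (x k) \<in> cis ` {b j..<b j + d}"
      unfolding cis_hit
    proof (intro allI impI)
      fix j assume "j < n"
      then show "\<exists>!k. k < n \<and> hit k j"
        using p0[of j] hit_p[of _ j] by (intro ex1I[of _ "p j"]) (auto simp: p_def)
    qed
    ultimately show ?thesis by simp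
  qed
qed

section \<open>Bounds on determinants\<close>

text \<open>Subtracting \<open>s\<close> times row \<open>k\<close> from row \<open>i\<close> keeps
  the determinant; each of the \<open>fact n\<close> Leibniz terms then has one factor of size at
  most \<eta>, the others being at most 1.\<close>

lemma abs_det_near_dependent_rows:
  fixes A :: "real mat"
  assumes A: "A \<in> carrier_mat n n"
    and bound: "\<And>i j. i < n \<Longrightarrow> j < n \<Longrightarrow> \<bar>A $$ (i, j)\<bar> \<le> 1"
    and ik: "i < n" "k < n" "i \<noteq> k"
    and near: "\<And>j. j < n \<Longrightarrow> \<bar>A $$ (i, j) - s * A $$ (k, j)\<bar> \<le> \<eta>"
  shows "\<bar>Determinant.det A\<bar> \<le> fact n * \<eta>"
proof -
  let ?B = "addrow (- s) i k A"
  have B: "?B \<in> carrier_mat n n" using A by simp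
  have "0 \<le> \<eta>" using near[OF ik(1)] by simp
  have "\<bar>Determinant.det A\<bar> = \<bar>Determinant.det ?B\<bar>"
    using det_addrow[OF ik(2,3) A, of "- s"] by simp
  also have "\<dots> \<le> (\<Sum>p | p permutes {0..<n}. \<bar>of_int (sign p) * (\<Prod>l = 0..<n. ?B $$ (l, p l))\<bar>)"
    unfolding det_def'[OF B] by (rule sum_abs)
  also have "\<dots> \<le> (\<Sum>p | p permutes {0..<n}. \<eta>)"
  proof (rule sum_mono, clarify)
    fix p assume p: "p permutes {0..<n}"
    have lt: "p l < n" if "l < n" for l using permutes_in_image[OF p, of l] that by simp
    have "(\<Prod>l = 0..<n. ?B $$ (l, p l)) = ?B $$ (i, p i) * (\<Prod>l\<in>{0..<n} - {i}. ?B $$ (l, p l))"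
      using ik by (subst prod.remove[of _ i]) auto
    then have "\<bar>of_int (sign p) * (\<Prod>l = 0..<n. ?B $$ (l, p l))\<bar> =
        \<bar>?B $$ (i, p i)\<bar> * (\<Prod>l\<in>{0..<n} - {i}. \<bar>?B $$ (l, p l)\<bar>)"
      by (simp add: abs_mult abs_prod sign_def)
    also have "\<dots> \<le> \<eta> * 1"
    proof (rule mult_mono)
      show "\<bar>?B $$ (i, p i)\<bar> \<le> \<eta>"
        using A ik lt[OF ik(1)] near[OF lt[OF ik(1)]] by (simp add: add.commute)
      show "(\<Prod>l\<in>{0..<n} - {i}. \<bar>?B $$ (l, p l)\<bar>) \<le> 1"
        using A bound lt by (intro prod_le_1) auto
    qed (use \<open>0 \<le> \<eta>\<close> in \<open>auto intro: prod_nonneg\<close>)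
    finally show "\<bar>of_int (sign p) * (\<Prod>l = 0..<n. ?B $$ (l, p l))\<bar> \<le> \<eta>" by simp
  qed
  also have "\<dots> = fact n * \<eta>"
    by (simp add: card_permutations[of _ n])
  finally show ?thesis .
qed

lemma abs_det_le_fact:
  fixes A :: "real mat"
  assumes A: "A \<in> carrier_mat n n"
    and bound: "\<And>i j. i < n \<Longrightarrow> j < n \<Longrightarrow> \<bar>A $$ (i, j)\<bar> \<le> 1"
  shows "\<bar>Determinant.det A\<bar> \<le> fact n"
proof -
  have "\<bar>Determinant.det A\<bar> \<le> (\<Sum>p | p permutes {0..<n}. \<bar>of_int (sign p) * (\<Prod>l = 0..<n. A $$ (l, p l))\<bar>)"
    unfolding det_def'[OF A] by (rule sum_abs)
  also have "\<dots> \<le> (\<Sum>p | p permutes {0..<n}. 1)"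
  proof (rule sum_mono, clarify)
    fix p assume p: "p permutes {0..<n}"
    have lt: "p l < n" if "l < n" for l using permutes_in_image[OF p, of l] that by simp
    have "\<bar>of_int (sign p) * (\<Prod>l = 0..<n. A $$ (l, p l))\<bar> = (\<Prod>l = 0..<n. \<bar>A $$ (l, p l)\<bar>)"
      by (simp add: abs_mult abs_prod sign_def)
    also have "\<dots> \<le> 1" using bound lt by (intro prod_le_1) auto
    finally show "\<bar>of_int (sign p) * (\<Prod>l = 0..<n. A $$ (l, p l))\<bar> \<le> 1" .
  qed
  also have "\<dots> = fact n" by (simp add: card_permutations[of _ n])
  finally show ?thesis .
qed

section \<open>Gaussian averages\<close>

lemma borel_measurable_arc_weight [measurable]: "arc_weight e c d \<in> borel_measurable borel"
proof -
  have [measurable]: "(\<lambda>y. e powi \<lfloor>(y - c) / (2 * pi)\<rfloor>) \<in> borel_measurable borel"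
    by (rule measurable_compose[where f = "\<lambda>y. \<lfloor>(y - c) / (2 * pi)\<rfloor>" and N = "count_space UNIV"]) measurable
  show ?thesis unfolding arc_weight_def Let_def by measurable
qed

lemma normal_density_le: "\<sigma> > 0 \<Longrightarrow> normal_density \<mu> \<sigma> x \<le> 1 / (sqrt (2 * pi) * \<sigma>)"
  by (simp add: normal_density_def real_sqrt_mult divide_simps)

lemma integrable_bounded_normal:
  fixes f :: "real \<Rightarrow> real"
  assumes "\<sigma> > 0" "f \<in> borel_measurable borel" "\<And>z. \<bar>f z\<bar> \<le> K"
  shows "integrable lborel (\<lambda>z. normal_density y \<sigma> z * f z)"
proof (rule Bochner_Integration.integrable_bound)
  show "integrable lborel (\<lambda>z. K * normal_density y \<sigma> z)" using assms by simp
  have "0 \<le> K" using assms(3)[of 0] by linarith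
  then show "AE z in lborel. norm (normal_density y \<sigma> z * f z) \<le> norm (K * normal_density y \<sigma> z)"
    using assms(3) by (auto simp: abs_mult mult.commute[of K] intro!: AE_I2 mult_left_mono)
qed (use assms in measurable)

text \<open>Gaussian densities of equal width cross at the midpoint \<open>m\<close> of their
  centres. Their L1 distance is therefore twice the mass of one of them on an interval of length
  \<open>y' - y\<close>, where the density is at most
  \<open>1 / (sqrt (2 * pi) * \<sigma>)\<close>.\<close>

lemma normal_shift_total_variation_aux:
  fixes f :: "real \<Rightarrow> real"
  assumes s: "\<sigma> > 0" and f: "f \<in> borel_measurable borel" "\<And>z. \<bar>f z\<bar> \<le> 1" and y: "y \<le> y'"
  shows "\<bar>(\<integral>z. normal_density y \<sigma> z * f z \<partial>lborel) - (\<integral>z. normal_density y' \<sigma> z * f z \<partial>lborel)\<bar> \<le> (y' - y) / \<sigma>"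
proof -
  let ?p = "normal_density y \<sigma>" and ?q = "normal_density y' \<sigma>"
  define m where "m = (y + y') / 2"
  note ib = integrable_bounded_normal[OF s]
  \<comment> \<open>As \<open>?p - ?q\<close> has integral 0, its absolute value integrates to twice
    its positive part, which lives to the left of \<open>m\<close>.\<close>
  have diff: "\<bar>?p z - ?q z\<bar> = 2 * ((?p z - ?q z) * indicator {..<m} z) - (?p z - ?q z)" for z
  proof -
    have "(z - y')\<^sup>2 - (z - y)\<^sup>2 = 2 * (y' - y) * (m - z)"
      by (simp add: m_def power2_eq_square field_simps)
    then have "z < m \<Longrightarrow> (z - y)\<^sup>2 \<le> (z - y')\<^sup>2" "z \<ge> m \<Longrightarrow> (z - y')\<^sup>2 \<le> (z - y)\<^sup>2"
      using y mult_nonneg_nonneg[of "2 * (y' - y)" "m - z"] mult_nonneg_nonneg[of "2 * (y' - y)" "z - m"]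
      by (auto simp: algebra_simps)
    then have "z < m \<Longrightarrow> ?q z \<le> ?p z" "z \<ge> m \<Longrightarrow> ?p z \<le> ?q z"
      using s by (auto simp: normal_density_def intro!: mult_left_mono divide_right_mono)
    then show ?thesis by (auto split: split_indicator)
  qed
  have pI: "integrable lborel (\<lambda>z. ?p z * indicator S z)" "integrable lborel (\<lambda>z. ?q z * indicator S z)"
    if [measurable]: "S \<in> sets borel" for S
    by (intro ib[where K = 1]; auto split: split_indicator)+
  have "(\<integral>z. ?q z * indicator {..<m} z \<partial>lborel) = (\<integral>z. ?q ((y' - y) + z) * indicator {..<m} ((y' - y) + z) \<partial>lborel)"
    using lborel_integral_real_affine[of 1 "\<lambda>z. ?q z * indicator {..<m} z" "y' - y"] by simp
  also have "\<dots> = (\<integral>z. ?p z * indicator {..<m - (y' - y)} z \<partial>lborel)"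
    by (rule Bochner_Integration.integral_cong) (auto simp: normal_density_def algebra_simps split: split_indicator)
  finally have shift: "(\<integral>z. ?q z * indicator {..<m} z \<partial>lborel) = \<dots>" .
  have "\<bar>(\<integral>z. ?p z * f z \<partial>lborel) - (\<integral>z. ?q z * f z \<partial>lborel)\<bar> = \<bar>\<integral>z. (?p z - ?q z) * f z \<partial>lborel\<bar>"
    using f by (subst Bochner_Integration.integral_diff[symmetric]) (auto intro!: ib[where K = 1] simp: left_diff_distrib)
  also have "\<dots> \<le> (\<integral>z. \<bar>(?p z - ?q z) * f z\<bar> \<partial>lborel)" by (rule integral_abs_bound)
  also have "\<dots> \<le> (\<integral>z. \<bar>?p z - ?q z\<bar> \<partial>lborel)"
  proof (rule integral_mono_AE)
    show "integrable lborel (\<lambda>z. \<bar>(?p z - ?q z) * f z\<bar>)"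
      using f by (intro Bochner_Integration.integrable_abs) (auto simp: left_diff_distrib intro!: ib[where K = 1])
    show "integrable lborel (\<lambda>z. \<bar>?p z - ?q z\<bar>)" using s by auto
    show "AE z in lborel. \<bar>(?p z - ?q z) * f z\<bar> \<le> \<bar>?p z - ?q z\<bar>"
      using f(2) by (auto simp: abs_mult intro!: mult_left_le)
  qed
  also have "\<dots> = (\<integral>z. 2 * (?p z * indicator {..<m} z - ?q z * indicator {..<m} z) - (?p z - ?q z) \<partial>lborel)"
    by (rule Bochner_Integration.integral_cong) (auto simp: diff left_diff_distrib)
  also have "\<dots> = 2 * ((\<integral>z. ?p z * indicator {..<m} z \<partial>lborel) - (\<integral>z. ?q z * indicator {..<m} z \<partial>lborel)) - (1 - 1)"
    using pI s by (subst Bochner_Integration.integral_diff, simp, simp, subst integral_mult_right_zero, subst Bochner_Integration.integral_diff, simp, simp, subst Bochner_Integration.integral_diff) auto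
  also have "\<dots> = 2 * (\<integral>z. ?p z * indicator {..<m} z - ?p z * indicator {..<m - (y' - y)} z \<partial>lborel)"
    unfolding shift using pI by (subst Bochner_Integration.integral_diff) auto
  also have "\<dots> \<le> 2 * (\<integral>z. 1 / (sqrt (2 * pi) * \<sigma>) * indicator {m - (y' - y)..<m} z \<partial>lborel)"
  proof (intro mult_left_mono integral_mono_AE AE_I2)
    show "integrable lborel (\<lambda>z. ?p z * indicator {..<m} z - ?p z * indicator {..<m - (y' - y)} z)"
      using pI by (intro Bochner_Integration.integrable_diff) auto
    show "integrable lborel (\<lambda>z. 1 / (sqrt (2 * pi) * \<sigma>) * indicator {m - (y' - y)..<m} z)"
      using y by (intro integrable_mult_right integrable_real_indicator) auto
    show "?p z * indicator {..<m} z - ?p z * indicator {..<m - (y' - y)} z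
        \<le> 1 / (sqrt (2 * pi) * \<sigma>) * indicator {m - (y' - y)..<m} z" for z
      using y normal_density_le[OF s, of y] by (auto split: split_indicator)
  qed simp
  also have "\<dots> = 2 / sqrt (2 * pi) * ((y' - y) / \<sigma>)"
    using y by simp
  also have "\<dots> \<le> 1 * ((y' - y) / \<sigma>)"
  proof (rule mult_right_mono)
    have "sqrt 4 \<le> sqrt (2 * pi)" using pi_ge_two by (subst real_sqrt_le_iff) linarith
    then show "2 / sqrt (2 * pi) \<le> 1" by simp
  qed (use y s in auto)
  finally show ?thesis by simp
qed

lemma normal_shift_total_variation:
  fixes f :: "real \<Rightarrow> real"
  assumes "\<sigma> > 0" "f \<in> borel_measurable borel" "\<And>z. \<bar>f z\<bar> \<le> 1"
  shows "\<bar>(\<integral>z. normal_density y \<sigma> z * f z \<partial>lborel) - (\<integral>z. normal_density y' \<sigma> z * f z \<partial>lborel)\<bar> \<le> \<bar>y' - y\<bar> / \<sigma>"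
  using normal_shift_total_variation_aux[OF assms, of y y'] normal_shift_total_variation_aux[OF assms, of y' y]
  by (cases "y \<le> y'") (auto simp: abs_minus_commute)

lemma (in prob_space) expectation_shifted_normal:
  fixes f :: "real \<Rightarrow> real"
  assumes s: "\<sigma> > 0" and W: "distributed M lborel W (normal_density 0 \<sigma>)" and f: "f \<in> borel_measurable borel"
  shows "expectation (\<lambda>\<omega>. f (y + W \<omega>)) = (\<integral>z. normal_density y \<sigma> z * f z \<partial>lborel)"
proof -
  have "expectation (\<lambda>\<omega>. f (y + W \<omega>)) = (\<integral>w. normal_density 0 \<sigma> w * f (y + w) \<partial>lborel)"
    using f by (intro distributed_integral[OF W, symmetric]) auto
  also have "\<dots> = (\<integral>w. normal_density y \<sigma> (y + w) * f (y + w) \<partial>lborel)"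
    by (simp add: normal_density_def)
  also have "\<dots> = (\<integral>z. normal_density y \<sigma> z * f z \<partial>lborel)"
    using lborel_integral_real_affine[of 1 "\<lambda>z. normal_density y \<sigma> z * f z" y] by simp
  finally show ?thesis .
qed


section \<open>Averages over shrinking arcs and the circle kernel\<close>

lemma normal_density_tail_bound:
  fixes c y \<sigma> :: real
  assumes s: "\<sigma> > 0"
  obtains C r where "C \<ge> 0" "0 < r" "r < 1"
    "\<And>k z. c + 2 * pi * of_int k \<le> z \<Longrightarrow> z \<le> c + 2 * pi * of_int k + 2 * pi \<Longrightarrow>
      normal_density y \<sigma> z \<le> C * r ^ nat \<bar>k\<bar>"
proof -
  \<comment> \<open>\<open>R\<close> absorbs the offset of \<open>c\<close> from \<open>y\<close>
    and the width of a period, giving \<open>|z - y| \<ge> |k| - R\<close> in period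
    \<open>k\<close>. The quadratic exponent is then weakened to a linear one by
    \<open>u^2 \<ge> 2 * u - 1\<close>, which produces \<open>C\<close> and the ratio
    \<open>r\<close>.\<close>
  define R where "R = \<bar>c - y\<bar> + 2 * pi"
  define C where "C = 1 / sqrt (2 * pi * \<sigma>\<^sup>2) * exp ((2 * R + 1) / (2 * \<sigma>\<^sup>2))"
  define r where "r = exp (- (1 / \<sigma>\<^sup>2))"
  show ?thesis
  proof (rule that[of C r])
    show "0 \<le> C" "0 < r" by (simp_all add: C_def r_def)
    show "r < 1" using s by (simp add: r_def)
    fix k :: int and z :: real
    assume z: "c + 2 * pi * of_int k \<le> z" "z \<le> c + 2 * pi * of_int k + 2 * pi"
    have "\<bar>2 * pi * of_int k\<bar> = 2 * pi * \<bar>of_int k\<bar>" by (simp add: abs_mult)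
    moreover have "1 * \<bar>real_of_int k\<bar> \<le> 2 * pi * \<bar>of_int k\<bar>"
      using pi_ge_two by (intro mult_right_mono) auto
    ultimately have "\<bar>of_int k\<bar> - R \<le> \<bar>z - y\<bar>" using z unfolding R_def by linarith
    moreover have "0 \<le> (\<bar>z - y\<bar> - 1)\<^sup>2" by simp
    then have "2 * \<bar>z - y\<bar> - 1 \<le> (z - y)\<^sup>2" by (simp add: power2_diff)
    moreover have "2 * u - (2 * R + 1) \<le> w" if "u - R \<le> v" "2 * v - 1 \<le> w" for u v w
      using that by linarith
    ultimately have "2 * \<bar>of_int k\<bar> - (2 * R + 1) \<le> (z - y)\<^sup>2" by blast
    then have "- (z - y)\<^sup>2 / (2 * \<sigma>\<^sup>2) \<le> ((2 * R + 1) - 2 * \<bar>of_int k\<bar>) / (2 * \<sigma>\<^sup>2)"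
      by (intro divide_right_mono) auto
    also have "\<dots> = (2 * R + 1) / (2 * \<sigma>\<^sup>2) + real (nat \<bar>k\<bar>) * - (1 / \<sigma>\<^sup>2)"
      using s by (simp add: field_simps)
    finally have "exp (- (z - y)\<^sup>2 / (2 * \<sigma>\<^sup>2)) \<le> exp ((2 * R + 1) / (2 * \<sigma>\<^sup>2)) * r ^ nat \<bar>k\<bar>"
      unfolding r_def exp_of_nat_mult[symmetric] exp_add[symmetric] by simp
    then show "normal_density y \<sigma> z \<le> C * r ^ nat \<bar>k\<bar>"
      unfolding normal_density_def C_def mult.assoc by (intro mult_left_mono) auto
  qed
qed

text \<open>Since \<open>m \<le> 2 * |int_decode m| + 1\<close>, the terms are dominated by a
  geometric series of ratio \<open>sqrt r\<close>.\<close>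

lemma summable_power_int_decode:
  assumes "0 < r" "r < (1::real)"
  shows "summable (\<lambda>m. r ^ nat \<bar>int_decode m\<bar>)"
proof (rule summable_comparison_test)
  show "\<exists>N. \<forall>m\<ge>N. norm (r ^ nat \<bar>int_decode m\<bar>) \<le> sqrt r ^ m / sqrt r"
  proof (intro exI allI impI)
    fix m :: nat
    have "m \<le> Suc (2 * nat \<bar>int_decode m\<bar>)"
      by (auto simp: int_decode_def sum_decode_def)
    then have "sqrt r ^ Suc (2 * nat \<bar>int_decode m\<bar>) \<le> sqrt r ^ m"
      using assms by (intro power_decreasing) auto
    moreover have "sqrt r ^ Suc (2 * nat \<bar>int_decode m\<bar>) = sqrt r * r ^ nat \<bar>int_decode m\<bar>"
      using assms by (simp add: power_mult)
    ultimately show "norm (r ^ nat \<bar>int_decode m\<bar>) \<le> sqrt r ^ m / sqrt r"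
      using assms by (simp add: field_simps)
  qed
  show "summable (\<lambda>m. sqrt r ^ m / sqrt r)"
    using assms by (intro summable_divide summable_geometric) auto
qed

lemma tendsto_average_at_right:
  fixes f :: "real \<Rightarrow> real"
  assumes f: "continuous_on UNIV f" "integrable lborel f"
  shows "((\<lambda>d. (\<integral>z. f z * indicator {p..<p + d} z \<partial>lborel) / d) \<longlongrightarrow> f p) (at_right 0)"
proof (rule tendstoI)
  fix \<epsilon> :: real assume \<epsilon>: "\<epsilon> > 0"
  then obtain \<delta> where \<delta>: "\<delta> > 0" "\<And>z. \<bar>z - p\<bar> < \<delta> \<Longrightarrow> \<bar>f z - f p\<bar> < \<epsilon> / 2"
    using f(1) unfolding continuous_on_iff dist_real_def by (metis UNIV_I half_gt_zero)
  have "dist ((\<integral>z. f z * indicator {p..<p + d} z \<partial>lborel) / d) (f p) < \<epsilon>" if d: "0 < d" "d < \<delta>" for d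
  proof -
    have i: "integrable lborel (\<lambda>z. f z * indicator {p..<p + d} z)"
      using f(2) by (intro integrable_real_mult_indicator) auto
    have j: "integrable lborel (\<lambda>z. c * indicator {p..<p + d} z)" for c :: real
      using d by (intro integrable_mult_right integrable_real_indicator) auto
    have J: "(\<integral>z. c * indicator {p..<p + d} z \<partial>lborel) = c * d" for c :: real
      using d by simp
    have "\<bar>(\<integral>z. f z * indicator {p..<p + d} z \<partial>lborel) - f p * d\<bar> =
        \<bar>\<integral>z. f z * indicator {p..<p + d} z - f p * indicator {p..<p + d} z \<partial>lborel\<bar>"
      unfolding J[symmetric] by (subst Bochner_Integration.integral_diff[OF i j]) simp
    also have "\<dots> \<le> (\<integral>z. \<bar>f z * indicator {p..<p + d} z - f p * indicator {p..<p + d} z\<bar> \<partial>lborel)"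
      by (rule integral_abs_bound)
    also have "\<dots> \<le> (\<integral>z. \<epsilon> / 2 * indicator {p..<p + d} z \<partial>lborel)"
    proof (intro integral_mono_AE AE_I2 j Bochner_Integration.integrable_abs Bochner_Integration.integrable_diff i)
      fix z show "\<bar>f z * indicator {p..<p + d} z - f p * indicator {p..<p + d} z\<bar> \<le> \<epsilon> / 2 * indicator {p..<p + d} z"
        using \<delta>(2)[of z] d by (auto split: split_indicator)
    qed
    also have "\<dots> = \<epsilon> / 2 * d" by (rule J)
    finally have "\<bar>(\<integral>z. f z * indicator {p..<p + d} z \<partial>lborel) - f p * d\<bar> / d \<le> \<epsilon> / 2"
      using d by (simp add: divide_le_eq)
    moreover have "\<bar>u - f p * d\<bar> / d = \<bar>u / d - f p\<bar>" for u
      using d abs_divide[of "u - f p * d" d] by (simp add: diff_divide_distrib)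
    ultimately show ?thesis using \<epsilon> by (simp add: dist_real_def)
  qed
  then show "\<forall>\<^sub>F d in at_right 0. dist ((\<integral>z. f z * indicator {p..<p + d} z \<partial>lborel) / d) (f p) < \<epsilon>"
    using \<delta>(1) by (auto simp: eventually_at_right_field)
qed

text \<open>The copies of the arc are enumerated by natural numbers so that termwise integration and
  Tannery's theorem apply; at each point at most one term is nonzero.\<close>

lemma arc_weight_sums:
  assumes "0 < d" "d \<le> 2 * pi"
  shows "(\<lambda>m. e powi int_decode m * indicator {c + 2 * pi * of_int (int_decode m)..<c + 2 * pi * of_int (int_decode m) + d} z)
    sums arc_weight e c d z"
proof -
  obtain k :: int where k: "c + 2 * pi * of_int k \<le> z" "z < c + 2 * pi * of_int k + 2 * pi"
    by (rule angle_cell)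
  have dec: "m = int_encode k" if "c + 2 * pi * of_int (int_decode m) \<le> z"
      "z < c + 2 * pi * of_int (int_decode m) + d" for m
  proof -
    have "2 * pi * of_int (int_decode m) < 2 * pi * of_int (k + 1)" "2 * pi * of_int k < 2 * pi * of_int (int_decode m + 1)"
      using k that assms by (auto simp: algebra_simps)
    then have "int_decode m < k + 1" "k < int_decode m + 1"
      by (simp_all only: mult_less_cancel_left_pos of_int_less_iff pi_gt_zero zero_less_mult_iff zero_less_numeral simp_thms)
    then have "int_decode m = k" by simp
    then show ?thesis by auto
  qed
  have "(\<lambda>m. e powi int_decode m * indicator {c + 2 * pi * of_int (int_decode m)..<c + 2 * pi * of_int (int_decode m) + d} z)
    = (\<lambda>m. if m = int_encode k then arc_weight e c d z else 0)"
  proof (rule ext)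
    fix m
    show "e powi int_decode m * indicator {c + 2 * pi * of_int (int_decode m)..<c + 2 * pi * of_int (int_decode m) + d} z
      = (if m = int_encode k then arc_weight e c d z else 0)"
      using dec[of m] k by (cases "m = int_encode k") (auto simp: arc_weight_eq[OF k] split: split_indicator)
  qed
  then show ?thesis using sums_single[of "int_encode k" "\<lambda>_. arc_weight e c d z"] by simp
qed


text \<open>Tannery's theorem: the contribution of a copy, divided by \<open>d\<close>, tends to the
  weighted density at the left end of that copy, and the geometric tail bound dominates it uniformly
  in \<open>d < 2 * pi\<close>.\<close>

lemma tendsto_arc_weight_average:
  fixes c y e \<sigma> :: real
  assumes s: "\<sigma> > 0" and e: "\<bar>e\<bar> = 1"
  shows "((\<lambda>d. (\<integral>z. normal_density y \<sigma> z * arc_weight e c d z \<partial>lborel) / d) \<longlongrightarrow>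
     (\<Sum>\<^sub>\<infinity>k. e powi k * normal_density y \<sigma> (c + 2 * pi * of_int k))) (at_right 0)"
proof -
  obtain C r where C: "0 \<le> C" and r: "0 < r" "r < 1"
    and Cr: "\<And>k z. c + 2 * pi * of_int k \<le> z \<Longrightarrow> z \<le> c + 2 * pi * of_int k + 2 * pi \<Longrightarrow>
      normal_density y \<sigma> z \<le> C * r ^ nat \<bar>k\<bar>"
    by (rule normal_density_tail_bound[OF s, where c = c and y = y]) blast
  let ?k = int_decode and ?p = "normal_density y \<sigma>"
  define I where "I m d = {c + 2 * pi * of_int (?k m)..<c + 2 * pi * of_int (?k m) + d}" for m d
  define a where "a m d = (e powi ?k m * (\<integral>z. ?p z * indicator (I m d) z \<partial>lborel)) / d" for m d
  define b where "b m = e powi ?k m * ?p (c + 2 * pi * of_int (?k m))" for m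
  define B where "B m = C * r ^ nat \<bar>?k m\<bar>" for m
  have [measurable]: "I m d \<in> sets borel" for m d by (simp add: I_def)
  have B: "summable B" unfolding B_def using r by (intro summable_mult summable_power_int_decode)
  have e_powi: "\<bar>e powi k\<bar> = 1" for k using e by (simp add: power_int_abs)
  have pI: "integrable lborel (\<lambda>z. ?p z * indicator (I m d) z)" for m d
    using s by (intro integrable_real_mult_indicator) auto
  have I_bound: "(\<integral>z. ?p z * indicator (I m d) z \<partial>lborel) \<le> B m * d" if "0 < d" "d \<le> 2 * pi" for m d
  proof -
    have "(\<integral>z. ?p z * indicator (I m d) z \<partial>lborel) \<le> (\<integral>z. B m * indicator (I m d) z \<partial>lborel)"
    proof (intro integral_mono_AE AE_I2 pI)
      show "integrable lborel (\<lambda>z. B m * indicator (I m d) z)"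
        using that by (intro integrable_mult_right integrable_real_indicator) (auto simp: I_def)
      show "?p z * indicator (I m d) z \<le> B m * indicator (I m d) z" for z
        using Cr[of "?k m" z] that by (auto simp: I_def B_def split: split_indicator)
    qed
    also have "\<dots> = B m * d" using that by (simp add: I_def)
    finally show ?thesis .
  qed
  have abs_I: "(\<integral>z. \<bar>e powi ?k m * (?p z * indicator (I m d) z)\<bar> \<partial>lborel) = (\<integral>z. ?p z * indicator (I m d) z \<partial>lborel)" for m d
    by (simp add: abs_mult e_powi)
  have sum: "(\<integral>z. ?p z * arc_weight e c d z \<partial>lborel) / d = (\<Sum>m. a m d)" if d: "0 < d" "d \<le> 2 * pi" for d
  proof -
    have sums: "(\<lambda>m. e powi ?k m * (?p z * indicator (I m d) z)) sums (?p z * arc_weight e c d z)" for z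
      using sums_mult[OF arc_weight_sums[OF d, of e c z], of "?p z"] by (simp add: I_def mult_ac)
    \<comment> \<open>Since \<open>e\<close> has modulus 1, the case \<open>e = 1\<close> provides
      the absolute convergence needed to integrate termwise.\<close>
    have sums1: "(\<lambda>m. 1 powi ?k m * (?p z * indicator (I m d) z)) sums (?p z * arc_weight 1 c d z)" for z
      using sums_mult[OF arc_weight_sums[OF d, of 1 c z], of "?p z"] by (simp add: I_def mult_ac)
    have "(\<integral>z. ?p z * arc_weight e c d z \<partial>lborel) = (\<integral>z. (\<Sum>m. e powi ?k m * (?p z * indicator (I m d) z)) \<partial>lborel)"
      using sums by (simp add: sums_iff)
    also have "\<dots> = (\<Sum>m. (\<integral>z. e powi ?k m * (?p z * indicator (I m d) z) \<partial>lborel))"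
    proof (rule integral_suminf)
      show "integrable lborel (\<lambda>z. e powi ?k m * (?p z * indicator (I m d) z))" for m
        using pI by (intro integrable_mult_right) auto
      show "AE z in lborel. summable (\<lambda>m. norm (e powi ?k m * (?p z * indicator (I m d) z)))"
        using sums1 by (intro AE_I2) (auto simp: abs_mult e_powi sums_iff)
      show "summable (\<lambda>m. \<integral>z. norm (e powi ?k m * (?p z * indicator (I m d) z)) \<partial>lborel)"
      proof (rule summable_comparison_test[OF _ summable_mult2[OF B, of d]], intro exI allI impI)
        fix m :: nat
        show "norm (\<integral>z. norm (e powi ?k m * (?p z * indicator (I m d) z)) \<partial>lborel) \<le> B m * d"
          using I_bound[OF d, of m] by (simp add: abs_I[unfolded abs_mult] abs_mult e_powi)
      qed
    qed
    also have "\<dots> / d = (\<Sum>m. a m d)"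
      unfolding a_def
    proof (subst suminf_divide[symmetric])
      show "summable (\<lambda>m. \<integral>z. e powi ?k m * (?p z * indicator (I m d) z) \<partial>lborel)"
      proof (rule summable_comparison_test[OF _ summable_mult2[OF B, of d]], intro exI allI impI)
        fix m :: nat
        show "norm (\<integral>z. e powi ?k m * (?p z * indicator (I m d) z) \<partial>lborel) \<le> B m * d"
          using I_bound[OF d, of m] by (simp add: abs_mult e_powi)
      qed
    qed simp
    finally show ?thesis .
  qed
  have tannery: "summable (\<lambda>m. norm (b m)) \<and> ((\<lambda>d. \<Sum>m. a m d) \<longlongrightarrow> suminf b) (at_right 0)"
  proof (rule conjunct2[OF tannerys_theorem[where M = B]])
    show "(a m \<longlongrightarrow> b m) (at_right 0)" for m
    proof -
      have "continuous_on UNIV ?p"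
        unfolding normal_density_def using s by (intro continuous_intros) auto
      then have "((\<lambda>d. e powi ?k m * ((\<integral>z. ?p z * indicator (I m d) z \<partial>lborel) / d)) \<longlongrightarrow> b m) (at_right 0)"
        unfolding b_def I_def using s by (intro tendsto_mult tendsto_const tendsto_average_at_right) auto
      then show ?thesis by (simp add: a_def[abs_def])
    qed
    have "\<forall>\<^sub>F d in at_right 0. \<forall>m. norm (a m d) \<le> B m"
      unfolding eventually_at_right_field
    proof (intro exI[of _ "2 * pi"] conjI allI impI)
      fix d m assume d: "0 < d" "d < 2 * pi"
      then show "norm (a m d) \<le> B m"
        using I_bound[of d m] by (simp add: a_def abs_mult e_powi divide_le_eq)
    qed simp
    then show "\<forall>\<^sub>F (m, d) in sequentially \<times>\<^sub>F at_right 0. norm (a m d) \<le> B m"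
      unfolding eventually_prod_filter
      by (intro exI[of _ "\<lambda>_. True"] exI[of _ "\<lambda>d. \<forall>m. norm (a m d) \<le> B m"]) auto
  qed (use B in auto)
  \<comment> \<open>Absolute convergence turns the enumerated series into an unordered sum over the
    integers.\<close>
  have "suminf b = infsum b UNIV"
    using tannery norm_summable_imp_has_sum[of b "suminf b"] by (metis infsumI summable_norm_cancel summable_sums)
  also have "\<dots> = (\<Sum>\<^sub>\<infinity>k. e powi k * ?p (c + 2 * pi * of_int k))"
    unfolding b_def by (rule infsum_reindex_bij_betw[OF bij_int_decode])
  finally have "((\<lambda>d. \<Sum>m. a m d) \<longlongrightarrow> (\<Sum>\<^sub>\<infinity>k. e powi k * ?p (c + 2 * pi * of_int k))) (at_right 0)"
    using tannery by simp
  moreover have "\<forall>\<^sub>F d in at_right 0. (\<Sum>m. a m d) = (\<integral>z. ?p z * arc_weight e c d z \<partial>lborel) / d"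
    unfolding eventually_at_right_field using sum by (intro exI[of _ "2 * pi"]) auto
  ultimately show ?thesis by (rule Lim_transform_eventually)
qed

lemma infsum_complex_of_real:
  "(\<Sum>\<^sub>\<infinity>x\<in>A. complex_of_real (f x)) = complex_of_real (\<Sum>\<^sub>\<infinity>x\<in>A. f x)"
proof (cases "f summable_on A")
  case True
  then show ?thesis by (metis has_sum_infsum has_sum_of_real_iff infsumI)
next
  \<comment> \<open>Neither family is summable, and both sums take the default value 0.\<close>
  case False
  then have "\<not> (\<lambda>x. complex_of_real (f x)) summable_on A"
    using summable_on_Re[of "\<lambda>x. complex_of_real (f x)" A] by auto
  with False show ?thesis by (simp add: infsum_not_exists)
qed

text \<open>The phase is \<open>(- 1) powi k\<close> for shift 1/2 and 1 for shift 0, hence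
  \<open>((- 1) ^ (n - 1)) powi k\<close> for both parities; the prefactor and the exponential form
  a Gaussian of variance \<open>t / n\<close>.\<close>

lemma circle_kernel_eq:
  assumes "n \<ge> 1" "t > 0"
  shows "circle_kernel n a b t (parity_shift n) =
    complex_of_real (\<Sum>\<^sub>\<infinity>k. ((- 1) ^ (n - 1)) powi k * normal_density a (sqrt (t / n)) (b + 2 * pi * of_int k))"
proof -
  have *: "exp (2 * of_int k * complex_of_real pi * complex_of_real (parity_shift n) * \<i>) =
      complex_of_real (((- 1) ^ (n - 1)) powi k)" for k :: int
  proof (cases "odd n")
    case True
    then show ?thesis by (simp add: parity_shift_def)
  next
    case False
    then have "((- 1) ^ (n - 1) :: real) = - 1" using assms(1) by (cases n) auto
    moreover have "exp (of_int k * complex_of_real pi * \<i>) = complex_of_real ((- 1) powi k)"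
    proof -
      have "exp (of_int k * complex_of_real pi * \<i>) = cis (pi * of_int k)"
        by (simp add: cis_conv_exp mult_ac)
      also have "\<dots> = complex_of_real ((- 1) powi k)"
        unfolding cos_pi_int[symmetric] by (simp add: complex_eq_iff sin_pi_int)
      finally show ?thesis .
    qed
    ultimately show ?thesis using False by (simp add: parity_shift_def)
  qed
  have d: "sqrt (real n / (2 * pi * t)) * exp (- (real n * (b - a + 2 * pi * real_of_int k)\<^sup>2 / (2 * t))) =
      normal_density a (sqrt (t / n)) (b + 2 * pi * of_int k)" for k
    using assms by (simp add: normal_density_def real_sqrt_divide real_sqrt_mult field_simps)
  have "circle_kernel n a b t (parity_shift n) =
     (\<Sum>\<^sub>\<infinity>k::int. complex_of_real (((- 1) ^ (n - 1)) powi k * normal_density a (sqrt (t / n)) (b + 2 * pi * of_int k)))"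
    unfolding circle_kernel_def * infsum_cmult_right'[symmetric] d[symmetric]
    by (simp add: mult_ac)
  also have "\<dots> = complex_of_real (\<Sum>\<^sub>\<infinity>k. ((- 1) ^ (n - 1)) powi k * normal_density a (sqrt (t / n)) (b + 2 * pi * of_int k))"
    by (rule infsum_complex_of_real)
  finally show ?thesis .
qed

section \<open>The Markov property along a grid\<close>

lemma det_mat_Leibniz:
  "Determinant.det (Matrix.mat n n (\<lambda>(i, j). g i j)) =
     (\<Sum>p | p permutes {0..<n}. of_int (sign p) * (\<Prod>i = 0..<n. g i (p i)))"
proof -
  have "(\<Prod>i = 0..<n. Matrix.mat n n (\<lambda>(i, j). g i j) $$ (i, p i)) = (\<Prod>i = 0..<n. g i (p i))"
    if "p permutes {0..<n}" for p
    using permutes_in_image[OF that] by (intro prod.cong) auto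
  then show ?thesis by (subst det_def'[of _ n]) auto
qed

text \<open>Stands in for conditional expectation in the Markov step: \<open>X\<close> is frozen
  while \<open>Y\<close> is averaged.\<close>

lemma (in prob_space) indep_var_expectation_Fubini:
  fixes \<Psi> :: "_ \<Rightarrow> real"
  assumes ind: "indep_var S X T Y" and \<Psi>: "\<Psi> \<in> borel_measurable (S \<Otimes>\<^sub>M T)" and bound: "\<And>z. \<bar>\<Psi> z\<bar> \<le> K"
  shows "expectation (\<lambda>\<omega>. \<Psi> (X \<omega>, Y \<omega>)) = expectation (\<lambda>\<omega>. expectation (\<lambda>\<omega>'. \<Psi> (X \<omega>, Y \<omega>')))"
proof -
  note [measurable] = indep_var_rv1[OF ind] indep_var_rv2[OF ind] \<Psi>
  interpret X: prob_space "distr M S X" by (rule prob_space_distr) measurable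
  interpret Y: prob_space "distr M T Y" by (rule prob_space_distr) measurable
  interpret XY: pair_prob_space "distr M S X" "distr M T Y" ..
  have "expectation (\<lambda>\<omega>. \<Psi> (X \<omega>, Y \<omega>)) = (\<integral>z. \<Psi> z \<partial>distr M (S \<Otimes>\<^sub>M T) (\<lambda>\<omega>. (X \<omega>, Y \<omega>)))"
    by (subst integral_distr) auto
  also have "\<dots> = (\<integral>z. \<Psi> z \<partial>(distr M S X \<Otimes>\<^sub>M distr M T Y))"
    using ind by (simp add: indep_var_distribution_eq)
  also have "\<dots> = (\<integral>x. \<integral>y. \<Psi> (x, y) \<partial>distr M T Y \<partial>distr M S X)"
  proof (rule XY.integral_fst'[symmetric], rule XY.integrable_const_bound)
    show "AE z in distr M S X \<Otimes>\<^sub>M distr M T Y. norm (\<Psi> z) \<le> K" using bound by auto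
  qed measurable
  also have "\<dots> = expectation (\<lambda>\<omega>. \<integral>y. \<Psi> (X \<omega>, y) \<partial>distr M T Y)"
    by (subst integral_distr) (auto intro!: borel_measurable_lebesgue_integral)
  also have "\<dots> = expectation (\<lambda>\<omega>. expectation (\<lambda>\<omega>'. \<Psi> (X \<omega>, Y \<omega>')))"
  proof (rule Bochner_Integration.integral_cong[OF refl])
    fix \<omega> assume "\<omega> \<in> space M"
    then have "X \<omega> \<in> space S" by (rule measurable_space[OF indep_var_rv1[OF ind]])
    then show "(\<integral>y. \<Psi> (X \<omega>, y) \<partial>distr M T Y) = expectation (\<lambda>\<omega>'. \<Psi> (X \<omega>, Y \<omega>'))"
      by (subst integral_distr) auto
  qed
  finally show ?thesis .
qed

text \<open>The integer \<open>m\<close> makes this a distance on the circle, and the inequality is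
  weak so that \<open>near n 0\<close> is an exact collision.\<close>

definition near :: "nat \<Rightarrow> real \<Rightarrow> (nat \<Rightarrow> real) \<Rightarrow> bool" where
  "near n \<delta> x \<longleftrightarrow> (\<exists>i<n. \<exists>j<n. i \<noteq> j \<and> (\<exists>m::int. \<bar>x i - x j - 2 * pi * of_int m\<bar> \<le> \<delta>))"

lemma near_cong: "(\<And>i. i < n \<Longrightarrow> x i = y i) \<Longrightarrow> near n \<delta> x \<longleftrightarrow> near n \<delta> y"
  by (simp add: near_def cong: conj_cong)

lemma measurable_near:
  assumes "\<And>i. i < n \<Longrightarrow> (\<lambda>\<omega>. x \<omega> i) \<in> borel_measurable N"
  shows "Measurable.pred N (\<lambda>\<omega>. near n \<delta> (x \<omega>))"
proof -
  have [measurable]: "(\<lambda>\<omega>. x \<omega> i) \<in> borel_measurable N" if "i \<in> {..<n}" for i using assms that by simp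
  have "near n \<delta> (x \<omega>) \<longleftrightarrow> (\<exists>i\<in>{..<n}. \<exists>j\<in>{..<n}. i \<noteq> j \<and> (\<exists>m::int. \<bar>x \<omega> i - x \<omega> j - 2 * pi * of_int m\<bar> \<le> \<delta>))" for \<omega>
    by (auto simp: near_def)
  then show ?thesis by simp
qed

text \<open>The properties of weighted arc indicators on which the collision argument rests; the
  arcs themselves return in \<open>prob_arcs\<close>. The multiplier \<open>e\<close> is common to
  all \<open>c\<close>, as proportionality of whole rows requires.\<close>

locale quasi_periodic_family =
  fixes f :: "nat \<Rightarrow> real \<Rightarrow> real" and e :: real
  assumes abs_e: "\<bar>e\<bar> = 1"
    and f_measurable [measurable]: "\<And>c. f c \<in> borel_measurable borel"
    and abs_f_le: "\<And>c y. \<bar>f c y\<bar> \<le> 1"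
    and f_shift: "\<And>c y m. f c (y + 2 * pi * of_int m) = e powi m * f c y"
begin

text \<open>The heat semigroup at variance \<sigma>^2 applied to \<open>f c\<close>.\<close>

definition smooth :: "real \<Rightarrow> nat \<Rightarrow> real \<Rightarrow> real" where
  "smooth \<sigma> c y = (\<integral>z. normal_density y \<sigma> z * f c z \<partial>lborel)"

lemma smooth_shift: "smooth \<sigma> c (y + 2 * pi * of_int m) = e powi m * smooth \<sigma> c y"
proof -
  have "smooth \<sigma> c (y + 2 * pi * of_int m) =
      (\<integral>z. normal_density (y + 2 * pi * of_int m) \<sigma> (2 * pi * of_int m + z) * f c (2 * pi * of_int m + z) \<partial>lborel)"
    unfolding smooth_def
    using lborel_integral_real_affine[of 1 "\<lambda>z. normal_density (y + 2 * pi * of_int m) \<sigma> z * f c z" "2 * pi * of_int m"]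
    by simp
  also have "\<dots> = (\<integral>z. e powi m * (normal_density y \<sigma> z * f c z) \<partial>lborel)"
    using f_shift[of c _ m] by (intro Bochner_Integration.integral_cong refl) (simp add: normal_density_def add.commute mult_ac)
  finally show ?thesis by (simp add: smooth_def)
qed

lemma abs_smooth_le: assumes "\<sigma> > 0" shows "\<bar>smooth \<sigma> c y\<bar> \<le> 1"
proof -
  have "\<bar>smooth \<sigma> c y\<bar> \<le> (\<integral>z. \<bar>normal_density y \<sigma> z * f c z\<bar> \<partial>lborel)"
    unfolding smooth_def by (rule integral_abs_bound)
  also have "\<dots> \<le> (\<integral>z. normal_density y \<sigma> z \<partial>lborel)"
    using assms abs_f_le
    by (intro integral_mono_AE AE_I2 Bochner_Integration.integrable_abs integrable_bounded_normal[where K = 1])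
      (auto simp: abs_mult intro!: mult_left_le)
  finally show ?thesis using assms by simp
qed

text \<open>All regularity comes from the Gaussian. The factor \<open>1 / \<sigma>\<close> is the
  reason why stopping has to end a positive time before \<open>t\<close>.\<close>

lemma smooth_lipschitz: "\<sigma> > 0 \<Longrightarrow> \<bar>smooth \<sigma> c y - smooth \<sigma> c y'\<bar> \<le> \<bar>y' - y\<bar> / \<sigma>"
  unfolding smooth_def by (rule normal_shift_total_variation) (auto simp: abs_f_le)

text \<open>At a near-collision two rows are almost proportional.\<close>
lemma abs_det_smooth_near:
  assumes "\<sigma> > 0" "near n \<delta> x"
  shows "\<bar>Determinant.det (Matrix.mat n n (\<lambda>(i, j). smooth \<sigma> j (x i)))\<bar> \<le> fact n * (\<delta> / \<sigma>)"
proof -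
  obtain i k m where ik: "i < n" "k < n" "i \<noteq> k" "\<bar>x i - x k - 2 * pi * of_int m\<bar> \<le> \<delta>"
    using assms(2) by (auto simp: near_def)
  show ?thesis
  proof (rule abs_det_near_dependent_rows[OF _ _ ik(1-3), where s = "e powi m"])
    fix j assume "j < n"
    have "\<bar>smooth \<sigma> j (x i) - smooth \<sigma> j (x k + 2 * pi * of_int m)\<bar> \<le> \<bar>x k + 2 * pi * of_int m - x i\<bar> / \<sigma>"
      by (rule smooth_lipschitz[OF assms(1)])
    also have "\<dots> \<le> \<delta> / \<sigma>" using ik(4) assms(1) by (intro divide_right_mono) auto
    finally show "\<bar>Matrix.mat n n (\<lambda>(i, j). smooth \<sigma> j (x i)) $$ (i, j) - e powi m * Matrix.mat n n (\<lambda>(i, j). smooth \<sigma> j (x i)) $$ (k, j)\<bar> \<le> \<delta> / \<sigma>"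
      using \<open>j < n\<close> ik by (simp add: smooth_shift)
  qed (use abs_smooth_le[OF assms(1)] in auto)
qed

text \<open>At an exact collision the rows are proportional before any smoothing; this settles the
  terminal time, where no time is left to average over.\<close>

lemma det_collision:
  assumes "near n 0 x"
  shows "Determinant.det (Matrix.mat n n (\<lambda>(i, j). f j (x i))) = 0"
proof -
  obtain i k m where ik: "i < n" "k < n" "i \<noteq> k" "\<bar>x i - x k - 2 * pi * of_int m\<bar> \<le> 0"
    using assms by (auto simp: near_def)
  then have "x i = x k + 2 * pi * of_int m" by simp
  then have "\<bar>Determinant.det (Matrix.mat n n (\<lambda>(i, j). f j (x i)))\<bar> \<le> fact n * 0"
    using abs_f_le ik
    by (intro abs_det_near_dependent_rows[OF _ _ ik(1-3), where s = "e powi m"]) (auto simp: f_shift)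
  then show ?thesis by simp
qed

end

text \<open>\<open>X k s\<close> is the angle of particle \<open>k\<close> lifted to the line,
  \<open>v\<close> its variance per unit of time. Independence is stated jointly over particles and
  time steps: the Markov step separates past from future and particle from particle.\<close>

locale gaussian_increments = prob_space M for M :: "'w measure" +
  fixes n :: nat and a :: "nat \<Rightarrow> real" and X :: "nat \<Rightarrow> real \<Rightarrow> 'w \<Rightarrow> real" and v :: real
  assumes v: "v > 0"
    and X_measurable: "\<And>k s. k < n \<Longrightarrow> 0 \<le> s \<Longrightarrow> X k s \<in> borel_measurable M"
    and X_continuous: "\<And>k \<omega>. k < n \<Longrightarrow> \<omega> \<in> space M \<Longrightarrow> continuous_on {0..} (\<lambda>s. X k s \<omega>)"
    and X_0: "\<And>k \<omega>. k < n \<Longrightarrow> \<omega> \<in> space M \<Longrightarrow> X k 0 \<omega> = a k"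
    and increment_normal: "\<And>k r s. k < n \<Longrightarrow> 0 \<le> r \<Longrightarrow> r < s \<Longrightarrow>
      distributed M lborel (\<lambda>\<omega>. X k s \<omega> - X k r \<omega>) (normal_density 0 (sqrt ((s - r) * v)))"
    and increments_indep: "\<And>m \<tau>. 0 \<le> \<tau> 0 \<Longrightarrow> strict_mono_on {..m} \<tau> \<Longrightarrow>
      indep_vars (\<lambda>_. borel) (\<lambda>(k, i) \<omega>. X k (\<tau> (Suc i)) \<omega> - X k (\<tau> i) \<omega>) ({..<n} \<times> {..<m})"

locale gaussian_increments_qp = gaussian_increments M n a X v + quasi_periodic_family f e
  for M :: "'w measure" and n a X v f e
begin

definition F :: "(nat \<Rightarrow> real) \<Rightarrow> real" where
  "F x = Determinant.det (Matrix.mat n n (\<lambda>(i, j). f j (x i)))"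

definition smooth_det :: "real \<Rightarrow> (nat \<Rightarrow> real) \<Rightarrow> real" where
  "smooth_det \<sigma> x = Determinant.det (Matrix.mat n n (\<lambda>(i, j). smooth \<sigma> j (x i)))"

lemma abs_F_le: "\<bar>F x\<bar> \<le> fact n"
  unfolding F_def by (rule abs_det_le_fact) (use abs_f_le in auto)

lemma measurable_F:
  assumes "\<And>i. i < n \<Longrightarrow> (\<lambda>\<omega>. x \<omega> i) \<in> borel_measurable N"
  shows "(\<lambda>\<omega>. F (x \<omega>)) \<in> borel_measurable N"
proof -
  have [measurable]: "(\<lambda>\<omega>. f j (x \<omega> i)) \<in> borel_measurable N" if "i \<in> {0..<n}" for i j
    using that assms by (auto intro: measurable_compose)
  show ?thesis unfolding F_def det_mat_Leibniz by measurable
qed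

text \<open>\<open>h\<close> collects the increments of the particles between consecutive grid times.\<close>
definition pos :: "nat \<Rightarrow> (nat \<times> nat \<Rightarrow> real) \<Rightarrow> nat \<Rightarrow> real" where
  "pos l h i = a i + (\<Sum>l'<l. h (i, l'))"

text \<open>The increments from \<open>\<tau> k\<close> to \<open>t\<close> are independent of the
  past \<open>H\<close>. With the past frozen, independence of the particles factorises each Leibniz
  term of \<open>F\<close>, which gives \<open>smooth_det\<close>. The other two conclusions allow
  events at grid times to be written as functions of \<open>H\<close>.\<close>

lemma markov:
  fixes \<tau> :: "nat \<Rightarrow> real" and k :: nat
  defines "I \<equiv> {..<n} \<times> {..<k}"
  defines "H \<equiv> \<lambda>\<omega>. restrict (\<lambda>(i, l). X i (\<tau> (Suc l)) \<omega> - X i (\<tau> l) \<omega>) I"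
  assumes \<tau>: "\<tau> 0 = 0" "strict_mono_on {..k} \<tau>" "\<tau> k < t"
    and G [measurable]: "G \<in> borel_measurable (PiM I (\<lambda>_. borel))" and G_bound: "\<And>h. \<bar>G h\<bar> \<le> 1"
  shows "expectation (\<lambda>\<omega>. G (H \<omega>) * F (\<lambda>i. X i t \<omega>)) =
     expectation (\<lambda>\<omega>. G (H \<omega>) * smooth_det (sqrt ((t - \<tau> k) * v)) (\<lambda>i. X i (\<tau> k) \<omega>))"
    and "H \<in> measurable M (PiM I (\<lambda>_. borel))"
    and "\<And>l i \<omega>. l \<le> k \<Longrightarrow> i < n \<Longrightarrow> \<omega> \<in> space M \<Longrightarrow> pos l (H \<omega>) i = X i (\<tau> l) \<omega>"
proof -
  \<comment> \<open>The final time is appended as grid point \<open>k + 1\<close>, so that past and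
    last step come from one independent family.\<close>
  define \<tau>' where "\<tau>' i = (if i \<le> k then \<tau> i else t)" for i
  define D where "D = (\<lambda>(i, l) \<omega>. X i (\<tau>' (Suc l)) \<omega> - X i (\<tau>' l) \<omega>)"
  define J where "J = {..<n} \<times> {k}"
  define Z where "Z \<omega> = restrict (\<lambda>p. D p \<omega>) J" for \<omega>
  define \<sigma> where "\<sigma> = sqrt ((t - \<tau> k) * v)"
  have \<sigma>: "\<sigma> > 0" using \<tau>(3) v by (simp add: \<sigma>_def)
  have mono: "strict_mono_on {..Suc k} \<tau>'"
  proof (rule strict_mono_onI)
    fix r s assume rs: "r \<in> {..Suc k}" "s \<in> {..Suc k}" "r < s"
    have "\<tau> r \<le> \<tau> k" using \<tau>(2) rs by (cases "r = k") (auto simp: strict_mono_on_def intro!: less_imp_le)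
    then show "\<tau>' r < \<tau>' s" using rs \<tau> by (auto simp: \<tau>'_def strict_mono_on_def)
  qed
  have \<tau>_nonneg: "0 \<le> \<tau> k"
    using \<tau> strict_mono_onD[OF \<tau>(2), of 0 k] by (cases "k = 0") auto
  have \<tau>'_0: "0 \<le> \<tau>' 0" using \<tau> by (simp add: \<tau>'_def)
  have indep: "indep_vars (\<lambda>_. borel) D ({..<n} \<times> {..<Suc k})"
    unfolding D_def by (rule increments_indep[OF \<tau>'_0 mono])
  have H_eq: "H = (\<lambda>\<omega>. restrict (\<lambda>p. D p \<omega>) I)"
    by (auto simp: H_def D_def I_def \<tau>'_def fun_eq_iff restrict_def)
  have HZ: "indep_var (PiM I (\<lambda>_. borel)) H (PiM J (\<lambda>_. borel)) Z"
    unfolding H_eq Z_def[abs_def] by (rule indep_var_restrict[OF indep]) (auto simp: I_def J_def)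
  show H [measurable]: "H \<in> measurable M (PiM I (\<lambda>_. borel))" using indep_var_rv1[OF HZ] .
  show pos: "pos l (H \<omega>) i = X i (\<tau> l) \<omega>" if "l \<le> k" "i < n" "\<omega> \<in> space M" for l i \<omega>
  proof -
    have "(\<Sum>l'<l. H \<omega> (i, l')) = (\<Sum>l'<l. X i (\<tau> (Suc l')) \<omega> - X i (\<tau> l') \<omega>)"
      using that by (intro sum.cong) (auto simp: H_def I_def)
    also have "\<dots> = X i (\<tau> l) \<omega> - X i (\<tau> 0) \<omega>" by (rule sum_lessThan_telescope)
    finally show ?thesis using that \<tau>(1) X_0 by (simp add: pos_def)
  qed
  have D_k: "D (i, k) \<omega> = X i t \<omega> - X i (\<tau> k) \<omega>" for i \<omega> by (simp add: D_def \<tau>'_def)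
  have D_meas: "D (i, k) \<in> borel_measurable M" if "i < n" for i
    using indep that by (auto simp: indep_vars_def)
  have smooth: "expectation (\<lambda>\<omega>. F (\<lambda>i. y i + D (i, k) \<omega>)) = smooth_det \<sigma> y" for y
  proof -
    have int1: "integrable M (\<lambda>\<omega>. f j (y i + D (i, k) \<omega>))" if "i < n" for i j
      using D_meas[OF that] abs_f_le by (intro integrable_const_bound[where B = 1]) auto
    have ind: "indep_vars (\<lambda>_. borel) (\<lambda>(i, l) \<omega>. f (p i) (y i + D (i, l) \<omega>)) ({0..<n} \<times> {k})" for p
    proof -
      have "indep_vars (\<lambda>_. borel) D ({0..<n} \<times> {k})"
        by (rule indep_vars_subset[OF indep]) auto
      then have "indep_vars (\<lambda>_. borel) (\<lambda>q \<omega>. (\<lambda>x. f (p (fst q)) (y (fst q) + x)) (D q \<omega>)) ({0..<n} \<times> {k})"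
        by (rule indep_vars_compose2) auto
      then show ?thesis by (simp add: case_prod_unfold)
    qed
    have prod_pairs: "(\<Prod>q\<in>{0..<n} \<times> {k}. g q) = (\<Prod>i = 0..<n. g (i, k))" for g :: "nat \<times> nat \<Rightarrow> real"
      using prod.cartesian_product[of "\<lambda>i l. g (i, l)" "{k}" "{0..<n}"] by (simp add: case_prod_unfold)
    note ii = indep_vars_integrable[OF _ ind, unfolded prod_pairs, simplified]
      and il = indep_vars_lebesgue_integral[OF _ ind, unfolded prod_pairs, simplified]
    have "expectation (\<lambda>\<omega>. F (\<lambda>i. y i + D (i, k) \<omega>)) =
      (\<Sum>p | p permutes {0..<n}. of_int (sign p) * expectation (\<lambda>\<omega>. \<Prod>i = 0..<n. f (p i) (y i + D (i, k) \<omega>)))"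
      unfolding F_def det_mat_Leibniz
      by (subst Bochner_Integration.integral_sum) (auto intro!: integrable_mult_right ii int1)
    also have "\<dots> = (\<Sum>p | p permutes {0..<n}. of_int (sign p) * (\<Prod>i = 0..<n. smooth \<sigma> (p i) (y i)))"
    proof (intro sum.cong refl arg_cong2[where f = "(*)"])
      fix p
      have "expectation (\<lambda>\<omega>. \<Prod>i = 0..<n. f (p i) (y i + D (i, k) \<omega>)) = (\<Prod>i = 0..<n. expectation (\<lambda>\<omega>. f (p i) (y i + D (i, k) \<omega>)))"
        by (rule il) (auto intro: int1)
      also have "\<dots> = (\<Prod>i = 0..<n. smooth \<sigma> (p i) (y i))"
      proof (intro prod.cong refl)
        fix i assume "i \<in> {0..<n}"
        then have "distributed M lborel (D (i, k)) (normal_density 0 \<sigma>)"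
          using increment_normal[of i "\<tau> k" t] \<tau>_nonneg \<tau>(3) by (simp add: D_k[abs_def] \<sigma>_def)
        then show "expectation (\<lambda>\<omega>. f (p i) (y i + D (i, k) \<omega>)) = smooth \<sigma> (p i) (y i)"
          unfolding smooth_def by (rule expectation_shifted_normal[OF \<sigma>]) simp
      qed
      finally show "expectation (\<lambda>\<omega>. \<Prod>i = 0..<n. f (p i) (y i + D (i, k) \<omega>)) = (\<Prod>i = 0..<n. smooth \<sigma> (p i) (y i))" .
    qed
    finally show ?thesis by (simp add: smooth_det_def det_mat_Leibniz)
  qed
  define \<Psi> where "\<Psi> = (\<lambda>(h, z). G h * F (\<lambda>i. pos k h i + z (i, k)))"
  have [measurable]: "\<Psi> \<in> borel_measurable (PiM I (\<lambda>_. borel) \<Otimes>\<^sub>M PiM J (\<lambda>_. borel))"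
  proof -
    have [measurable]: "(\<lambda>x. F (\<lambda>i. pos k (fst x) i + snd x (i, k))) \<in> borel_measurable (PiM I (\<lambda>_. borel) \<Otimes>\<^sub>M PiM J (\<lambda>_. borel))"
    proof (rule measurable_F)
      fix i assume "i < n"
      then have 1: "(i, k) \<in> J" "\<And>l. l \<in> {..<k} \<Longrightarrow> (i, l) \<in> I" by (auto simp: I_def J_def)
      have [measurable]: "(\<lambda>x. fst x (i, l)) \<in> borel_measurable (PiM I (\<lambda>_. borel) \<Otimes>\<^sub>M PiM J (\<lambda>_. borel))" if "l \<in> {..<k}" for l
        using measurable_compose[OF measurable_fst measurable_component_singleton[OF 1(2)[OF that], of "\<lambda>_. borel"], of "PiM J (\<lambda>_. borel)"] by simp
      have [measurable]: "(\<lambda>x. snd x (i, k)) \<in> borel_measurable (PiM I (\<lambda>_. borel) \<Otimes>\<^sub>M PiM J (\<lambda>_. borel))"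
        using measurable_compose[OF measurable_snd measurable_component_singleton[OF 1(1), of "\<lambda>_. borel"], of "PiM I (\<lambda>_. borel)"] by simp
      show "(\<lambda>x. pos k (fst x) i + snd x (i, k)) \<in> borel_measurable (PiM I (\<lambda>_. borel) \<Otimes>\<^sub>M PiM J (\<lambda>_. borel))"
        unfolding pos_def by measurable
    qed
    show ?thesis unfolding \<Psi>_def case_prod_beta by measurable
  qed
  have bound: "\<bar>\<Psi> z\<bar> \<le> fact n" for z
    using mult_mono[OF G_bound[of "fst z"] abs_F_le] by (auto simp: \<Psi>_def case_prod_beta abs_mult)
  have F_cong: "F x = F y" if "\<And>i. i < n \<Longrightarrow> x i = y i" for x y
    unfolding F_def by (rule arg_cong[where f = Determinant.det]) (auto intro!: eq_matI simp: that)
  have sd_cong: "smooth_det \<sigma> x = smooth_det \<sigma> y" if "\<And>i. i < n \<Longrightarrow> x i = y i" for x y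
    unfolding smooth_det_def by (rule arg_cong[where f = Determinant.det]) (auto intro!: eq_matI simp: that)
  have "expectation (\<lambda>\<omega>. G (H \<omega>) * F (\<lambda>i. X i t \<omega>)) = expectation (\<lambda>\<omega>. \<Psi> (H \<omega>, Z \<omega>))"
    unfolding \<Psi>_def using pos[of k]
    by (intro Bochner_Integration.integral_cong refl) (auto simp: Z_def J_def D_k intro!: F_cong)
  also have "\<dots> = expectation (\<lambda>\<omega>. expectation (\<lambda>\<omega>'. \<Psi> (H \<omega>, Z \<omega>')))"
    by (rule indep_var_expectation_Fubini[OF HZ _ bound]) measurable
  also have "\<dots> = expectation (\<lambda>\<omega>. G (H \<omega>) * smooth_det \<sigma> (\<lambda>i. X i (\<tau> k) \<omega>))"
  proof (intro Bochner_Integration.integral_cong refl)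
    fix \<omega> assume \<omega>: "\<omega> \<in> space M"
    have "expectation (\<lambda>\<omega>'. \<Psi> (H \<omega>, Z \<omega>')) = expectation (\<lambda>\<omega>'. G (H \<omega>) * F (\<lambda>i. pos k (H \<omega>) i + D (i, k) \<omega>'))"
      unfolding \<Psi>_def by (intro Bochner_Integration.integral_cong refl) (auto simp: Z_def J_def intro!: F_cong)
    also have "\<dots> = G (H \<omega>) * smooth_det \<sigma> (pos k (H \<omega>))" by (simp add: smooth)
    also have "smooth_det \<sigma> (pos k (H \<omega>)) = smooth_det \<sigma> (\<lambda>i. X i (\<tau> k) \<omega>)"
      by (rule sd_cong) (simp add: pos \<omega>)
    finally show "expectation (\<lambda>\<omega>'. \<Psi> (H \<omega>, Z \<omega>')) = G (H \<omega>) * smooth_det \<sigma> (\<lambda>i. X i (\<tau> k) \<omega>)" .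
  qed
  finally show "expectation (\<lambda>\<omega>. G (H \<omega>) * F (\<lambda>i. X i t \<omega>)) =
     expectation (\<lambda>\<omega>. G (H \<omega>) * smooth_det (sqrt ((t - \<tau> k) * v)) (\<lambda>i. X i (\<tau> k) \<omega>))"
    by (simp add: \<sigma>_def)
qed

end

section \<open>Stopping at the first near-collision\<close>

context gaussian_increments_qp begin

lemma F_measurable [measurable]: "0 \<le> s \<Longrightarrow> (\<lambda>\<omega>. F (\<lambda>i. X i s \<omega>)) \<in> borel_measurable M"
  by (rule measurable_F) (rule X_measurable)

lemma near_measurable: "0 \<le> s \<Longrightarrow> Measurable.pred M (\<lambda>\<omega>. near n \<delta> (\<lambda>i. X i s \<omega>))"
  by (rule measurable_near) (rule X_measurable)

text \<open>Optional stopping at the first grid time at which two particles are within \<open>\<delta>\<close> of each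
  other: by the Markov property the part of the expectation stopped there is an expectation of
  nearly singular determinants.\<close>
lemma stopping_bound:
  fixes \<tau> :: "nat \<Rightarrow> real" and N :: nat
  assumes \<tau>: "\<tau> 0 = 0" "strict_mono_on {..N} \<tau>" "\<tau> N \<le> T" "T < t" and \<delta>: "0 \<le> \<delta>"
  shows "\<bar>expectation (\<lambda>\<omega>. F (\<lambda>i. X i t \<omega>)) -
      expectation (\<lambda>\<omega>. F (\<lambda>i. X i t \<omega>) * of_bool (\<forall>k\<le>N. \<not> near n \<delta> (\<lambda>i. X i (\<tau> k) \<omega>)))\<bar>
    \<le> fact n * (\<delta> / sqrt ((t - T) * v))"
proof -
  define C where "C = fact n * (\<delta> / sqrt ((t - T) * v))"
  have C: "0 \<le> C" using \<delta> \<tau> v by (simp add: C_def)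
  define Y where "Y \<omega> = F (\<lambda>i. X i t \<omega>)" for \<omega>
  define R where "R k \<omega> \<longleftrightarrow> near n \<delta> (\<lambda>i. X i (\<tau> k) \<omega>)" for k \<omega>
  define A where "A k \<omega> \<longleftrightarrow> R k \<omega> \<and> (\<forall>l<k. \<not> R l \<omega>)" for k \<omega>
  have \<tau>_nonneg: "0 \<le> \<tau> k" if "k \<le> N" for k
    using \<tau>(1) strict_mono_onD[OF \<tau>(2), of 0 k] that by (cases "k = 0") auto
  have \<tau>_le: "\<tau> k \<le> T" if "k \<le> N" for k
    using \<tau>(3) strict_mono_onD[OF \<tau>(2), of k N] that by (cases "k = N") auto
  have "0 \<le> T" using \<tau>_nonneg[of 0] \<tau>_le[of 0] by simp
  have R_meas [measurable]: "Measurable.pred M (R k)" if "k \<in> {..N}" for k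
    unfolding R_def[abs_def] using that \<tau>_nonneg by (intro near_measurable) auto
  have A_meas [measurable]: "Measurable.pred M (A k)" if "k \<in> {..N}" for k
  proof -
    have [measurable]: "Measurable.pred M (R k)" "\<And>l. l \<in> {..<k} \<Longrightarrow> Measurable.pred M (R l)" using that by auto
    have "A k = (\<lambda>\<omega>. R k \<omega> \<and> (\<forall>l\<in>{..<k}. \<not> R l \<omega>))" by (auto simp: A_def fun_eq_iff)
    then show ?thesis by simp
  qed
  have Y_meas [measurable]: "Y \<in> borel_measurable M"
    unfolding Y_def[abs_def] using \<open>0 \<le> T\<close> \<tau>(4) by (intro F_measurable) auto
  have Y_int: "integrable M (\<lambda>\<omega>. Y \<omega> * of_bool (P \<omega>))" if [measurable]: "Measurable.pred M P" for P
  proof (rule integrable_const_bound[where B = "fact n"])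
    show "AE \<omega> in M. norm (Y \<omega> * of_bool (P \<omega>)) \<le> fact n" by (auto simp: Y_def abs_F_le)
  qed measurable
  have A_int: "integrable M (\<lambda>\<omega>. of_bool (A k \<omega>) :: real)" if "k \<in> {..N}" for k
    using A_meas[OF that] by (intro integrable_const_bound[where B = 1]) auto
  have none_meas [measurable]: "Measurable.pred M (\<lambda>\<omega>. \<forall>k\<le>N. \<not> R k \<omega>)"
  proof -
    have "(\<lambda>\<omega>. \<forall>k\<le>N. \<not> R k \<omega>) = (\<lambda>\<omega>. \<forall>k\<in>{..N}. \<not> R k \<omega>)" by auto
    then show ?thesis by simp
  qed
  have first: "1 = of_bool (\<forall>k\<le>N. \<not> R k \<omega>) + (\<Sum>k\<le>N. of_bool (A k \<omega>) :: real)" for \<omega>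
  proof (cases "\<exists>k\<le>N. R k \<omega>")
    case True
    define k where "k = (LEAST k. R k \<omega>)"
    have k: "R k \<omega>" "k \<le> N" "\<And>l. l < k \<Longrightarrow> \<not> R l \<omega>"
      using True unfolding k_def by (auto intro: LeastI Least_le order_trans dest: not_less_Least)
    have "A l \<omega> \<longleftrightarrow> l = k" for l
      using k by (auto simp: A_def) (metis linorder_neqE_nat)
    then show ?thesis using True k(2) by simp
  qed (auto simp: A_def)
  have stopped: "\<bar>expectation (\<lambda>\<omega>. Y \<omega> * of_bool (A k \<omega>))\<bar> \<le> C * expectation (\<lambda>\<omega>. of_bool (A k \<omega>))"
    if k: "k \<in> {..N}" for k
  proof -
    define I where "I = {..<n} \<times> {..<k}"
    define H where "H \<omega> = restrict (\<lambda>(i, l). X i (\<tau> (Suc l)) \<omega> - X i (\<tau> l) \<omega>) I" for \<omega>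
    \<comment> \<open>The event \<open>A k\<close> as a function of the increments up to
      \<open>\<tau> k\<close>, the form that \<open>markov\<close> accepts.\<close>
    define G :: "(nat \<times> nat \<Rightarrow> real) \<Rightarrow> real"
      where "G h = of_bool (near n \<delta> (pos k h) \<and> (\<forall>l\<in>{..<k}. \<not> near n \<delta> (pos l h)))" for h
    have \<tau>k: "strict_mono_on {..k} \<tau>" "\<tau> k < t"
      using k \<tau>(2,4) \<tau>_le[of k] by (auto simp: strict_mono_on_def)
    have [measurable]: "Measurable.pred (PiM I (\<lambda>_. borel)) (\<lambda>h. near n \<delta> (pos l h))" if l: "l \<le> k" for l
    proof (rule measurable_near)
      fix i assume "i < n"
      then have "(\<lambda>h. h (i, l')) \<in> borel_measurable (PiM I (\<lambda>_. borel))" if "l' \<in> {..<l}" for l'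
        using that l measurable_component_singleton[of "(i, l')" I "\<lambda>_. borel"] by (auto simp: I_def)
      then show "(\<lambda>h. pos l h i) \<in> borel_measurable (PiM I (\<lambda>_. borel))"
        unfolding pos_def by (intro borel_measurable_add borel_measurable_sum) auto
    qed
    have G_meas: "G \<in> borel_measurable (PiM I (\<lambda>_. borel))"
      unfolding G_def[abs_def] by measurable
    note mk = markov[OF \<tau>(1) \<tau>k, folded I_def, folded H_def]
    have G_eq: "G (H \<omega>) = of_bool (A k \<omega>)" if "\<omega> \<in> space M" for \<omega>
    proof -
      have "near n \<delta> (pos l (H \<omega>)) \<longleftrightarrow> R l \<omega>" if "l \<le> k" for l
        unfolding R_def using that \<open>\<omega> \<in> space M\<close> by (intro near_cong mk(3)[OF G_meas]) (auto simp: G_def)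
      then show ?thesis by (auto simp: G_def A_def)
    qed
    have "expectation (\<lambda>\<omega>. Y \<omega> * of_bool (A k \<omega>)) = expectation (\<lambda>\<omega>. G (H \<omega>) * F (\<lambda>i. X i t \<omega>))"
      by (intro Bochner_Integration.integral_cong refl) (simp add: G_eq Y_def)
    also have "\<dots> = expectation (\<lambda>\<omega>. G (H \<omega>) * smooth_det (sqrt ((t - \<tau> k) * v)) (\<lambda>i. X i (\<tau> k) \<omega>))"
      by (rule mk(1)[OF G_meas]) (simp add: G_def)
    finally have "\<bar>expectation (\<lambda>\<omega>. Y \<omega> * of_bool (A k \<omega>))\<bar> \<le>
        expectation (\<lambda>\<omega>. \<bar>G (H \<omega>) * smooth_det (sqrt ((t - \<tau> k) * v)) (\<lambda>i. X i (\<tau> k) \<omega>)\<bar>)"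
      by simp
    also have "\<dots> \<le> expectation (\<lambda>\<omega>. C * of_bool (A k \<omega>))"
    proof (rule integral_mono_AE')
      show "integrable M (\<lambda>\<omega>. C * of_bool (A k \<omega>))" using A_int[OF k] by simp
      have "\<bar>G (H \<omega>) * smooth_det (sqrt ((t - \<tau> k) * v)) (\<lambda>i. X i (\<tau> k) \<omega>)\<bar> \<le> C * of_bool (A k \<omega>)"
        if "\<omega> \<in> space M" for \<omega>
      proof (cases "A k \<omega>")
        case True
        have "\<bar>smooth_det (sqrt ((t - \<tau> k) * v)) (\<lambda>i. X i (\<tau> k) \<omega>)\<bar> \<le> fact n * (\<delta> / sqrt ((t - \<tau> k) * v))"
          unfolding smooth_det_def using True \<tau>k v by (intro abs_det_smooth_near) (auto simp: A_def R_def)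
        \<comment> \<open>At least \<open>t - T\<close> of time remains, which makes the bound the
          same for all \<open>k\<close>.\<close>
        also have "\<dots> \<le> C"
          unfolding C_def using k \<tau>_le[of k] \<tau>(4) \<delta> v
          by (intro mult_left_mono divide_left_mono real_sqrt_le_mono mult_right_mono mult_pos_pos) auto
        finally show ?thesis using True that by (simp add: G_eq)
      qed (use that in \<open>simp add: G_eq\<close>)
      then show "AE \<omega> in M. \<bar>G (H \<omega>) * smooth_det (sqrt ((t - \<tau> k) * v)) (\<lambda>i. X i (\<tau> k) \<omega>)\<bar> \<le> C * of_bool (A k \<omega>)"
        by (intro AE_I2)
    qed (use C in auto)
    finally show ?thesis by simp
  qed
  have "expectation Y = expectation (\<lambda>\<omega>. Y \<omega> * of_bool (\<forall>k\<le>N. \<not> R k \<omega>) + (\<Sum>k\<le>N. Y \<omega> * of_bool (A k \<omega>)))"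
    by (intro Bochner_Integration.integral_cong refl)
      (simp only: sum_distrib_left[symmetric] distrib_left[symmetric] first[symmetric] mult_1_right)
  also have "\<dots> = expectation (\<lambda>\<omega>. Y \<omega> * of_bool (\<forall>k\<le>N. \<not> R k \<omega>)) + (\<Sum>k\<le>N. expectation (\<lambda>\<omega>. Y \<omega> * of_bool (A k \<omega>)))"
  proof -
    have i: "integrable M (\<lambda>\<omega>. Y \<omega> * of_bool (A k \<omega>))" if "k \<in> {..N}" for k
      using Y_int A_meas that by blast
    have "expectation (\<lambda>\<omega>. \<Sum>k\<le>N. Y \<omega> * of_bool (A k \<omega>)) = (\<Sum>k\<le>N. expectation (\<lambda>\<omega>. Y \<omega> * of_bool (A k \<omega>)))"
      by (rule Bochner_Integration.integral_sum) (rule i)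
    then show ?thesis
      using Bochner_Integration.integral_add[OF Y_int[OF none_meas] Bochner_Integration.integrable_sum[of "{..N}", OF i]]
      by (simp only:)
  qed
  finally have "\<bar>expectation Y - expectation (\<lambda>\<omega>. Y \<omega> * of_bool (\<forall>k\<le>N. \<not> R k \<omega>))\<bar> =
      \<bar>\<Sum>k\<le>N. expectation (\<lambda>\<omega>. Y \<omega> * of_bool (A k \<omega>))\<bar>" by simp
  also have "\<dots> \<le> (\<Sum>k\<le>N. C * expectation (\<lambda>\<omega>. of_bool (A k \<omega>)))"
    by (rule order_trans[OF sum_abs sum_mono]) (rule stopped)
  also have "\<dots> = C * expectation (\<lambda>\<omega>. \<Sum>k\<le>N. of_bool (A k \<omega>))"
    using A_int by (subst Bochner_Integration.integral_sum) (auto simp: sum_distrib_left)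
  \<comment> \<open>The events \<open>A k\<close> are disjoint, so their probabilities add up to at
    most 1 and the number of grid points drops out.\<close>
  also have "\<dots> \<le> C * 1"
  proof (rule mult_left_mono[OF _ C])
    have "expectation (\<lambda>\<omega>. \<Sum>k\<le>N. of_bool (A k \<omega>)) \<le> expectation (\<lambda>_. 1 :: real)"
    proof (rule integral_mono_AE')
      show "AE \<omega> in M. (\<Sum>k\<le>N. of_bool (A k \<omega>)) \<le> (1 :: real)"
      proof (rule AE_I2)
        fix \<omega>
        have "(0 :: real) \<le> of_bool (\<forall>k\<le>N. \<not> R k \<omega>)" by simp
        then show "(\<Sum>k\<le>N. of_bool (A k \<omega>)) \<le> (1 :: real)" using first[of \<omega>] by linarith
      qed
    qed auto
    then show "expectation (\<lambda>\<omega>. \<Sum>k\<le>N. of_bool (A k \<omega>)) \<le> (1 :: real)" by (simp add: prob_space)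
  qed
  finally show ?thesis by (simp add: Y_def[abs_def] R_def C_def)
qed

end

section \<open>Collisions of continuous paths\<close>

definition no_collision :: "nat \<Rightarrow> real set \<Rightarrow> (nat \<Rightarrow> real \<Rightarrow> real) \<Rightarrow> bool" where
  "no_collision n S y \<longleftrightarrow> (\<forall>s\<in>S. \<not> near n 0 (\<lambda>i. y i s))"

lemma near_mono: "near n \<delta> x \<Longrightarrow> \<delta> \<le> \<delta>' \<Longrightarrow> near n \<delta>' x"
  unfolding near_def by (meson order_trans)

text \<open>Continuity keeps the colliding pair close at the last dyadic time not after the
  collision, once the mesh \<open>T / 2 ^ m\<close> is below the modulus \<eta>.\<close>

lemma collision_imp_near_grid:
  assumes y: "\<And>i. i < n \<Longrightarrow> continuous_on {0..T} (y i)" and T: "0 < T" and \<delta>: "\<delta> > 0"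
    and s: "s \<in> {0..T}" and coll: "near n 0 (\<lambda>i. y i s)"
  shows "\<exists>m. \<exists>k\<le>2 ^ m. near n \<delta> (\<lambda>i. y i (T * real k / 2 ^ m))"
proof -
  obtain i j l where ij: "i < n" "j < n" "i \<noteq> j" "\<bar>y i s - y j s - 2 * pi * of_int l\<bar> \<le> 0"
    using coll by (auto simp: near_def)
  have "continuous_on {0..T} (\<lambda>s. y i s - y j s - 2 * pi * of_int l)"
    using y ij by (intro continuous_intros) auto
  then obtain \<eta> where \<eta>: "\<eta> > 0" "\<And>s'. s' \<in> {0..T} \<Longrightarrow> \<bar>s' - s\<bar> < \<eta> \<Longrightarrow>
      \<bar>(y i s' - y j s' - 2 * pi * of_int l) - (y i s - y j s - 2 * pi * of_int l)\<bar> < \<delta>"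
    unfolding continuous_on_iff dist_real_def using s \<delta> by metis
  obtain m :: nat where m: "T / \<eta> < 2 ^ m" using real_arch_pow[of 2] by auto
  define k where "k = nat \<lfloor>s * 2 ^ m / T\<rfloor>"
  have q: "0 \<le> s * 2 ^ m / T" "s * 2 ^ m / T \<le> 2 ^ m" using s T by (auto simp: field_simps)
  have k: "real k \<le> s * 2 ^ m / T" "s * 2 ^ m / T < real k + 1"
    using q by (auto simp: k_def intro!: of_nat_floor)
  have "real k \<le> 2 ^ m" using k(1) q(2) by linarith
  then have k_le: "k \<le> 2 ^ m" by (metis of_nat_le_iff of_nat_numeral of_nat_power)
  have le: "T * real k / 2 ^ m \<le> s" using k(1) T by (simp add: field_simps)
  have "s < T * (real k + 1) / 2 ^ m" using k(2) T by (simp add: field_simps)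
  then have "s - T * real k / 2 ^ m < T / 2 ^ m" by (simp add: distrib_left add_divide_distrib)
  also have "\<dots> < \<eta>" using m \<eta>(1) by (simp add: field_simps)
  finally have "\<bar>T * real k / 2 ^ m - s\<bar> < \<eta>" using le by simp
  moreover have "T * real k / 2 ^ m \<in> {0..T}" using le s T by auto
  ultimately have "\<bar>y i (T * real k / 2 ^ m) - y j (T * real k / 2 ^ m) - 2 * pi * of_int l\<bar> \<le> \<delta>"
    using \<eta>(2) ij(4) by force
  then show ?thesis using ij(1-3) k_le unfolding near_def by blast
qed

text \<open>Compactness: the product \<open>h\<close> of all
  \<open>|sin ((y i s - y j s) / 2)|\<close> is continuous and positive, hence bounded below. Each
  factor is at most 1 and that of a \<delta>-close pair at most \<delta>, so \<open>near\<close>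
  forces \<open>h \<le> \<delta>\<close>. The sine measures distance modulo \<open>2 * pi\<close>
  without a choice of lift.\<close>

lemma no_collision_gap:
  assumes y: "\<And>i. i < n \<Longrightarrow> continuous_on {0..T} (y i)" and T: "0 \<le> T" and nc: "no_collision n {0..T} y"
  shows "\<exists>\<delta>>0. \<forall>s\<in>{0..T}. \<not> near n \<delta> (\<lambda>i. y i s)"
proof -
  let ?P = "{(i, j). i < n \<and> j < n \<and> i \<noteq> j}"
  have fin: "finite ?P" by (rule finite_subset[of _ "{..<n} \<times> {..<n}"]) auto
  define h where "h s = (\<Prod>(i, j)\<in>?P. \<bar>sin ((y i s - y j s) / 2)\<bar>)" for s
  have cont: "continuous_on {0..T} h"
    unfolding h_def case_prod_beta using y by (intro continuous_intros) auto
  have factor: "\<bar>sin ((y i s - y j s) / 2)\<bar> \<le> \<bar>y i s - y j s - 2 * pi * of_int m\<bar>" for i j s and m :: int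
  proof -
    have "sin ((y i s - y j s) / 2 - pi * of_int m) = (- 1) powi m * sin ((y i s - y j s) / 2)"
      by (rule sin_minus_pi_int)
    then have "\<bar>sin ((y i s - y j s) / 2)\<bar> = \<bar>sin ((y i s - y j s) / 2 - pi * of_int m)\<bar>"
      by (simp add: abs_mult power_int_abs)
    also have "\<dots> \<le> \<bar>(y i s - y j s) / 2 - pi * of_int m\<bar>" by (rule abs_sin_x_le_abs_x)
    also have "\<dots> \<le> \<bar>y i s - y j s - 2 * pi * of_int m\<bar>" by (simp add: abs_if field_simps)
    finally show ?thesis .
  qed
  have h_le: "h s \<le> \<delta>" if nr: "near n \<delta> (\<lambda>i. y i s)" for s \<delta>
  proof -
    obtain i j m where ij: "i < n" "j < n" "i \<noteq> j" "\<bar>y i s - y j s - 2 * pi * of_int m\<bar> \<le> \<delta>"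
      using nr unfolding near_def by blast
    have "h s = \<bar>sin ((y i s - y j s) / 2)\<bar> * (\<Prod>(i, j)\<in>?P - {(i, j)}. \<bar>sin ((y i s - y j s) / 2)\<bar>)"
      unfolding h_def using fin ij by (subst prod.remove[of _ "(i, j)"]) auto
    also have "\<dots> \<le> \<bar>sin ((y i s - y j s) / 2)\<bar> * 1"
      by (intro mult_left_mono prod_le_1) auto
    also have "\<dots> \<le> \<delta>" using factor[of i s j m] ij(4) by linarith
    finally show ?thesis .
  qed
  have h_pos: "0 < h s" if "s \<in> {0..T}" for s
    unfolding h_def
  proof (rule prod_pos, clarify)
    fix i j assume ij: "i < n" "j < n" "i \<noteq> j"
    have "sin ((y i s - y j s) / 2) \<noteq> 0"
    proof
      assume "sin ((y i s - y j s) / 2) = 0"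
      then obtain m :: int where "(y i s - y j s) / 2 = of_int m * pi" unfolding sin_zero_iff_int2 by blast
      then have "\<bar>y i s - y j s - 2 * pi * of_int m\<bar> \<le> 0" by simp
      then show False using nc that ij unfolding no_collision_def near_def by blast
    qed
    then show "0 < \<bar>sin ((y i s - y j s) / 2)\<bar>" by simp
  qed
  obtain s0 where s0: "s0 \<in> {0..T}" "\<And>s. s \<in> {0..T} \<Longrightarrow> h s0 \<le> h s"
    using continuous_attains_inf[OF compact_Icc _ cont] T by auto
  \<comment> \<open>Half the minimum of \<open>h\<close> serves: \<open>near\<close> at that level
    would push \<open>h\<close> below its minimum.\<close>
  show ?thesis
  proof (intro exI[of _ "h s0 / 2"] conjI ballI notI)
    show "0 < h s0 / 2" using h_pos[OF s0(1)] by simp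
    fix s assume "s \<in> {0..T}" "near n (h s0 / 2) (\<lambda>i. y i s)"
    then have "h s0 \<le> h s0 / 2" using s0(2) h_le by force
    then show False using h_pos[OF s0(1)] by simp
  qed
qed

text \<open>A difference of two lifts is continuous and never a multiple of \<open>2 * pi\<close>,
  so it cannot leave the interval between 0 and \<open>2 * pi\<close>.\<close>

lemma no_collision_alcove:
  assumes y: "\<And>i. i < n \<Longrightarrow> continuous_on {0..T} (y i)" and T: "0 \<le> T" and nc: "no_collision n {0..T} y"
    and 0: "alcove n (\<lambda>i. y i 0)"
  shows "alcove n (\<lambda>i. y i T)"
  unfolding alcove_def
proof (intro allI impI)
  fix i j assume ij: "j < n" "i < j"
  define g where "g s = y j s - y i s" for s
  have cont: "continuous_on {0..T} g" unfolding g_def using y ij by (intro continuous_intros) auto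
  have ne: "g s \<noteq> 2 * pi * of_int m" if "s \<in> {0..T}" for s and m :: int
  proof
    assume "g s = 2 * pi * of_int m"
    then have "\<bar>y j s - y i s - 2 * pi * of_int m\<bar> \<le> 0" by (simp add: g_def)
    moreover have "i < n" "j < n" "j \<noteq> i" using ij by auto
    ultimately show False using nc that unfolding no_collision_def near_def by blast
  qed
  have "y i 0 < y j 0 \<and> y j 0 < y i 0 + 2 * pi" using 0 ij unfolding alcove_def by blast
  then have g0: "0 < g 0" "g 0 < 2 * pi" by (auto simp: g_def)
  have "0 < g T"
  proof (rule ccontr)
    assume "\<not> 0 < g T"
    then obtain s where "0 \<le> s" "s \<le> T" "g s = 0" using IVT2'[OF _ _ T cont, of 0] g0 by auto
    then show False using ne[of s 0] by simp
  qed
  moreover have "g T < 2 * pi"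
  proof (rule ccontr)
    assume "\<not> g T < 2 * pi"
    then obtain s where "0 \<le> s" "s \<le> T" "g s = 2 * pi" using IVT'[OF _ _ T cont, of "2 * pi"] g0 by auto
    then show False using ne[of s 1] by simp
  qed
  ultimately show "y i T < y j T \<and> y j T < y i T + 2 * pi" by (simp add: g_def)
qed

text \<open>Countable form of a condition on uncountably many times, for measurability and for the
  limits below. The threshold is uniform over all grids: the gap lemma supplies it, and conversely a
  collision produces grid near-collisions below every threshold.\<close>

lemma no_collision_iff_grid:
  assumes y: "\<And>i. i < n \<Longrightarrow> continuous_on {0..T} (y i)" and T: "0 < T"
  shows "no_collision n {0..T} y \<longleftrightarrow>
    (\<exists>p::nat. \<forall>m. \<forall>k\<in>{..(2::nat) ^ m}. \<not> near n (1 / Suc p) (\<lambda>i. y i (T * real k / 2 ^ m)))"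
proof
  assume "no_collision n {0..T} y"
  then obtain \<delta> where \<delta>: "\<delta> > 0" "\<And>s. s \<in> {0..T} \<Longrightarrow> \<not> near n \<delta> (\<lambda>i. y i s)"
    using no_collision_gap[of n T y] y T by (auto simp del: atLeastAtMost_iff)
  obtain p :: nat where p: "1 / Suc p < \<delta>" using \<delta>(1) by (metis nat_approx_posE)
  have "T * real k / 2 ^ m \<in> {0..T}" if "k \<le> 2 ^ m" for k m :: nat
  proof -
    have "real k \<le> 2 ^ m" using that by (metis of_nat_le_iff of_nat_numeral of_nat_power)
    then show ?thesis using T by (auto simp: divide_le_eq)
  qed
  note grid = this
  show "\<exists>p::nat. \<forall>m. \<forall>k\<in>{..(2::nat) ^ m}. \<not> near n (1 / Suc p) (\<lambda>i. y i (T * real k / 2 ^ m))"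
  proof (intro exI[of _ p] allI ballI notI)
    fix m k :: nat assume k: "k \<in> {..2 ^ m}" "near n (1 / Suc p) (\<lambda>i. y i (T * real k / 2 ^ m))"
    have "near n \<delta> (\<lambda>i. y i (T * real k / 2 ^ m))"
      by (rule near_mono[OF k(2)]) (use p in simp)
    then show False using \<delta>(2)[OF grid[of k m]] k(1) by simp
  qed
next
  assume "\<exists>p::nat. \<forall>m. \<forall>k\<in>{..(2::nat) ^ m}. \<not> near n (1 / Suc p) (\<lambda>i. y i (T * real k / 2 ^ m))"
  then obtain p :: nat where p: "\<And>m k. k \<le> (2::nat) ^ m \<Longrightarrow> \<not> near n (1 / Suc p) (\<lambda>i. y i (T * real k / 2 ^ m))"
    by auto
  show "no_collision n {0..T} y"
    unfolding no_collision_def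
  proof (intro ballI notI)
    fix s assume s: "s \<in> {0..T}" and c: "near n 0 (\<lambda>i. y i s)"
    have "\<exists>m. \<exists>k\<le>2 ^ m. near n (1 / Suc p) (\<lambda>i. y i (T * real k / 2 ^ m))"
      by (rule collision_imp_near_grid[OF y T _ s c]) auto
    then show False using p by blast
  qed
qed

lemma measurable_no_collision:
  assumes Y: "\<And>i s. i < n \<Longrightarrow> 0 \<le> s \<Longrightarrow> Y i s \<in> borel_measurable N"
    and cont: "\<And>i \<omega>. i < n \<Longrightarrow> \<omega> \<in> space N \<Longrightarrow> continuous_on {0..} (\<lambda>s. Y i s \<omega>)" and T: "0 < T"
  shows "Measurable.pred N (\<lambda>\<omega>. no_collision n {0..T} (\<lambda>i s. Y i s \<omega>))"
proof -
  have [measurable]: "Measurable.pred N (\<lambda>\<omega>. near n \<delta> (\<lambda>i. Y i (T * real k / 2 ^ m) \<omega>))" for \<delta> k m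
    using Y T by (intro measurable_near) auto
  have "Measurable.pred N (\<lambda>\<omega>. \<exists>p::nat. \<forall>m. \<forall>k\<in>{..(2::nat) ^ m}. \<not> near n (1 / Suc p) (\<lambda>i. Y i (T * real k / 2 ^ m) \<omega>))"
    by measurable
  also have "?this \<longleftrightarrow> ?thesis"
    using T by (intro measurable_cong no_collision_iff_grid[symmetric]) (auto intro!: continuous_on_subset[OF cont])
  finally show ?thesis .
qed

section \<open>Limits in the mesh, the threshold and the stopping horizon\<close>

context gaussian_increments_qp begin

abbreviation nc :: "real set \<Rightarrow> 'w \<Rightarrow> bool" where
  "nc S \<omega> \<equiv> no_collision n S (\<lambda>i s. X i s \<omega>)"

lemma nc_measurable: "0 < T \<Longrightarrow> Measurable.pred M (nc {0..T})"
  by (rule measurable_no_collision) (use X_measurable X_continuous in auto)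

text \<open>Dominated convergence with the constant \<open>fact n\<close>; the three limits below
  differ only in the events, which stabilise at each outcome.\<close>

lemma expectation_of_bool_tendsto:
  assumes s: "0 \<le> s" and U: "\<And>m. Measurable.pred M (U m)" and V: "Measurable.pred M V"
    and lim: "\<And>\<omega>. \<omega> \<in> space M \<Longrightarrow> \<forall>\<^sub>F m in sequentially. U m \<omega> = V \<omega>"
  shows "(\<lambda>m. expectation (\<lambda>\<omega>. F (\<lambda>i. X i s \<omega>) * of_bool (U m \<omega>))) \<longlonglongrightarrow>
    expectation (\<lambda>\<omega>. F (\<lambda>i. X i s \<omega>) * of_bool (V \<omega>))"
proof (rule integral_dominated_convergence[where w = "\<lambda>_. fact n"])
  note [measurable] = U V F_measurable[OF s]
  show "(\<lambda>\<omega>. F (\<lambda>i. X i s \<omega>) * of_bool (V \<omega>)) \<in> borel_measurable M"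
    "(\<lambda>\<omega>. F (\<lambda>i. X i s \<omega>) * of_bool (U m \<omega>)) \<in> borel_measurable M" for m
    by measurable
  show "AE \<omega> in M. (\<lambda>m. F (\<lambda>i. X i s \<omega>) * of_bool (U m \<omega>)) \<longlonglongrightarrow> F (\<lambda>i. X i s \<omega>) * of_bool (V \<omega>)"
  proof (rule AE_I2)
    fix \<omega> assume "\<omega> \<in> space M"
    from lim[OF this] show "(\<lambda>m. F (\<lambda>i. X i s \<omega>) * of_bool (U m \<omega>)) \<longlonglongrightarrow> F (\<lambda>i. X i s \<omega>) * of_bool (V \<omega>)"
      by (intro tendsto_eventually) (auto elim!: eventually_mono)
  qed
  show "AE \<omega> in M. norm (F (\<lambda>i. X i s \<omega>) * of_bool (U m \<omega>)) \<le> fact n" for m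
    using abs_F_le by auto
qed simp

text \<open>The estimate in \<open>stopping_bound\<close> is uniform in the grid and thus survives
  its refinement.\<close>

lemma dyadic_bound:
  assumes T: "0 < T" "T < t" and \<delta>: "0 \<le> \<delta>"
  shows "\<bar>expectation (\<lambda>\<omega>. F (\<lambda>i. X i t \<omega>)) - expectation (\<lambda>\<omega>. F (\<lambda>i. X i t \<omega>) *
      of_bool (\<forall>m. \<forall>k\<in>{..(2::nat) ^ m}. \<not> near n \<delta> (\<lambda>i. X i (T * real k / 2 ^ m) \<omega>)))\<bar>
    \<le> fact n * (\<delta> / sqrt ((t - T) * v))"
proof -
  define U where "U m \<omega> \<longleftrightarrow> (\<forall>k\<in>{..(2::nat) ^ m}. \<not> near n \<delta> (\<lambda>i. X i (T * real k / 2 ^ m) \<omega>))" for m \<omega>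
  have [measurable]: "Measurable.pred M (\<lambda>\<omega>. near n \<delta> (\<lambda>i. X i (T * real k / 2 ^ m) \<omega>))" for k m
    using T by (intro near_measurable) auto
  have [measurable]: "Measurable.pred M (U m)" for m unfolding U_def[abs_def] by measurable
  have ev: "\<forall>\<^sub>F m in sequentially. U m \<omega> = (\<forall>m. U m \<omega>)" for \<omega>
  proof (cases "\<forall>m. U m \<omega>")
    case False
    then obtain m0 k0 where k0: "k0 \<le> (2::nat) ^ m0" "near n \<delta> (\<lambda>i. X i (T * real k0 / 2 ^ m0) \<omega>)"
      by (auto simp: U_def)
    \<comment> \<open>Dyadic grids are nested, so a near-collision on one of them is seen on all
      finer ones.\<close>
    have "\<not> U m \<omega>" if "m0 \<le> m" for m
    proof -
      have m: "2 ^ m = 2 ^ m0 * (2 ^ (m - m0) :: 'a::comm_semiring_1)" using that by (simp flip: power_add)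
      have "k0 * 2 ^ (m - m0) \<le> 2 ^ m" unfolding m using k0(1) by simp
      moreover have "T * real (k0 * 2 ^ (m - m0)) / 2 ^ m = T * real k0 / 2 ^ m0"
        unfolding m by simp
      ultimately show ?thesis using k0(2) unfolding U_def by (metis atMost_iff)
    qed
    then show ?thesis using False unfolding eventually_sequentially by blast
  qed simp
  have "(\<lambda>m. expectation (\<lambda>\<omega>. F (\<lambda>i. X i t \<omega>) * of_bool (U m \<omega>))) \<longlonglongrightarrow>
    expectation (\<lambda>\<omega>. F (\<lambda>i. X i t \<omega>) * of_bool (\<forall>m. U m \<omega>))"
    using T ev by (intro expectation_of_bool_tendsto) auto
  then have "(\<lambda>m. \<bar>expectation (\<lambda>\<omega>. F (\<lambda>i. X i t \<omega>)) - expectation (\<lambda>\<omega>. F (\<lambda>i. X i t \<omega>) * of_bool (U m \<omega>))\<bar>) \<longlonglongrightarrow>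
    \<bar>expectation (\<lambda>\<omega>. F (\<lambda>i. X i t \<omega>)) - expectation (\<lambda>\<omega>. F (\<lambda>i. X i t \<omega>) * of_bool (\<forall>m. U m \<omega>))\<bar>"
    by (intro tendsto_intros)
  then have "\<bar>expectation (\<lambda>\<omega>. F (\<lambda>i. X i t \<omega>)) - expectation (\<lambda>\<omega>. F (\<lambda>i. X i t \<omega>) * of_bool (\<forall>m. U m \<omega>))\<bar>
      \<le> fact n * (\<delta> / sqrt ((t - T) * v))"
  proof (rule LIMSEQ_le_const2, intro exI allI impI)
    fix m :: nat
    have "\<bar>expectation (\<lambda>\<omega>. F (\<lambda>i. X i t \<omega>)) - expectation (\<lambda>\<omega>. F (\<lambda>i. X i t \<omega>) *
        of_bool (\<forall>k\<le>2 ^ m. \<not> near n \<delta> (\<lambda>i. X i (T * real k / 2 ^ m) \<omega>)))\<bar> \<le> fact n * (\<delta> / sqrt ((t - T) * v))"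
      using T \<delta> by (intro stopping_bound) (auto simp: strict_mono_on_def divide_strict_right_mono)
    then show "\<bar>expectation (\<lambda>\<omega>. F (\<lambda>i. X i t \<omega>)) - expectation (\<lambda>\<omega>. F (\<lambda>i. X i t \<omega>) * of_bool (U m \<omega>))\<bar>
      \<le> fact n * (\<delta> / sqrt ((t - T) * v))"
      by (simp only: U_def Ball_def atMost_iff)
  qed
  then show ?thesis by (simp only: U_def)
qed

text \<open>For the threshold \<open>1 / Suc p\<close> the error in \<open>dyadic_bound\<close>
  tends to 0, while the events \<open>U p\<close> increase to absence of collisions on
  \<open>[0, T]\<close>: two limits of one sequence are compared.\<close>

lemma expectation_no_collision_before:
  assumes T: "0 < T" "T < t"
  shows "expectation (\<lambda>\<omega>. F (\<lambda>i. X i t \<omega>)) = expectation (\<lambda>\<omega>. F (\<lambda>i. X i t \<omega>) * of_bool (nc {0..T} \<omega>))"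
proof -
  define U where "U p \<omega> \<longleftrightarrow> (\<forall>m. \<forall>k\<in>{..(2::nat) ^ m}. \<not> near n (1 / Suc p) (\<lambda>i. X i (T * real k / 2 ^ m) \<omega>))" for p \<omega>
  let ?E = "expectation (\<lambda>\<omega>. F (\<lambda>i. X i t \<omega>))" and ?C = "fact n / sqrt ((t - T) * v)"
  have [measurable]: "Measurable.pred M (\<lambda>\<omega>. near n \<delta> (\<lambda>i. X i (T * real k / 2 ^ m) \<omega>))" for \<delta> k m
    using T by (intro near_measurable) auto
  have [measurable]: "Measurable.pred M (U m)" for m unfolding U_def[abs_def] by measurable
  have U_mono: "U q \<omega>" if "U p \<omega>" "p \<le> q" for p q \<omega>
  proof -
    have "(1::real) / Suc q \<le> 1 / Suc p" using that(2) by (simp add: frac_le)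
    then show ?thesis using that(1) near_mono[of n "1 / Suc q" _ "1 / Suc p"] unfolding U_def by blast
  qed
  have iff: "nc {0..T} \<omega> \<longleftrightarrow> (\<exists>p. U p \<omega>)" if "\<omega> \<in> space M" for \<omega>
    unfolding U_def using T that by (intro no_collision_iff_grid) (auto intro!: continuous_on_subset[OF X_continuous])
  have lim_nc: "(\<lambda>p. expectation (\<lambda>\<omega>. F (\<lambda>i. X i t \<omega>) * of_bool (U p \<omega>))) \<longlonglongrightarrow>
    expectation (\<lambda>\<omega>. F (\<lambda>i. X i t \<omega>) * of_bool (nc {0..T} \<omega>))"
  proof (rule expectation_of_bool_tendsto)
    fix \<omega> assume \<omega>: "\<omega> \<in> space M"
    show "\<forall>\<^sub>F p in sequentially. U p \<omega> = nc {0..T} \<omega>"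
      unfolding iff[OF \<omega>] eventually_sequentially using U_mono by (cases "\<exists>p. U p \<omega>") blast+
  qed (use T nc_measurable in auto)
  have lim_E: "(\<lambda>p. expectation (\<lambda>\<omega>. F (\<lambda>i. X i t \<omega>) * of_bool (U p \<omega>))) \<longlonglongrightarrow> ?E"
  proof (rule LIM_zero_cancel, rule Lim_null_comparison)
    show "\<forall>\<^sub>F p in sequentially. norm (expectation (\<lambda>\<omega>. F (\<lambda>i. X i t \<omega>) * of_bool (U p \<omega>)) - ?E) \<le> ?C * (1 / Suc p)"
    proof (rule always_eventually, rule allI)
      fix p
      show "norm (expectation (\<lambda>\<omega>. F (\<lambda>i. X i t \<omega>) * of_bool (U p \<omega>)) - ?E) \<le> ?C * (1 / Suc p)"
        using dyadic_bound[OF T, of "1 / Suc p"]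
        by (simp only: U_def real_norm_def abs_minus_commute[of _ ?E]) (simp add: mult.commute)
    qed
    show "(\<lambda>p. ?C * (1 / Suc p)) \<longlonglongrightarrow> 0"
      by (intro tendsto_mult_right_zero LIMSEQ_Suc[OF lim_1_over_n])
  qed
  show ?thesis by (rule LIMSEQ_unique[OF lim_E lim_nc])
qed

text \<open>Letting \<open>T\<close> increase to \<open>t\<close> excludes collisions on
  \<open>[0, t)\<close>; a collision at time \<open>t\<close> itself makes \<open>F\<close>
  vanish.\<close>

lemma expectation_no_collision:
  assumes t: "0 < t"
  shows "expectation (\<lambda>\<omega>. F (\<lambda>i. X i t \<omega>)) = expectation (\<lambda>\<omega>. F (\<lambda>i. X i t \<omega>) * of_bool (nc {0..t} \<omega>))"
proof -
  \<comment> \<open>With \<open>p + 2\<close> rather than \<open>p + 1\<close>, already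
    \<open>T 0\<close> is positive.\<close>
  define T where "T p = t * (1 - 1 / real (p + 2))" for p :: nat
  have T: "0 < T p" "T p < t" for p using t by (auto simp: T_def field_simps intro: add_pos_nonneg)
  have T_mono: "T p \<le> T q" if "p \<le> q" for p q
    unfolding T_def using that t by (intro mult_left_mono diff_left_mono divide_left_mono) auto
  have T_lim: "\<exists>p. s \<le> T p" if "s < t" for s
  proof -
    have "(t - s) / t > 0" using that t by simp
    then obtain p :: nat where p: "1 / real (Suc p) < (t - s) / t" by (metis nat_approx_posE)
    have "1 / real (p + 2) \<le> 1 / real (Suc p)" by (simp add: field_simps)
    with p have "t * (1 / real (p + 2)) \<le> t * ((t - s) / t)" using t by (intro mult_left_mono) auto
    moreover have "t * ((t - s) / t) = t - s" using t by simp
    ultimately show ?thesis by (intro exI[of _ p]) (simp add: T_def right_diff_distrib)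
  qed
  have "{0..<t} = (\<Union>p. {0..T p})"
    using T_lim by (auto intro: order_le_less_trans[OF _ T(2)])
  then have iff: "nc {0..<t} \<omega> \<longleftrightarrow> (\<forall>p. nc {0..T p} \<omega>)" for \<omega>
    by (simp add: no_collision_def)
  have [measurable]: "Measurable.pred M (nc {0..T p})" for p by (rule nc_measurable[OF T(1)])
  have "(\<lambda>p. expectation (\<lambda>\<omega>. F (\<lambda>i. X i t \<omega>) * of_bool (nc {0..T p} \<omega>))) \<longlonglongrightarrow>
    expectation (\<lambda>\<omega>. F (\<lambda>i. X i t \<omega>) * of_bool (nc {0..<t} \<omega>))"
  proof (rule expectation_of_bool_tendsto)
    have mono: "nc {0..T p} \<omega>" if "nc {0..T q} \<omega>" "p \<le> q" for p q \<omega>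
      using that T_mono[of p q] by (auto simp: no_collision_def)
    show "\<forall>\<^sub>F p in sequentially. nc {0..T p} \<omega> = nc {0..<t} \<omega>" for \<omega>
      unfolding iff eventually_sequentially using mono by (cases "\<forall>p. nc {0..T p} \<omega>") blast+
  qed (use t in \<open>auto simp: iff\<close>)
  moreover have "expectation (\<lambda>\<omega>. F (\<lambda>i. X i t \<omega>) * of_bool (nc {0..T p} \<omega>)) = expectation (\<lambda>\<omega>. F (\<lambda>i. X i t \<omega>))" for p
    by (rule expectation_no_collision_before[OF T, symmetric])
  ultimately have "expectation (\<lambda>\<omega>. F (\<lambda>i. X i t \<omega>)) = expectation (\<lambda>\<omega>. F (\<lambda>i. X i t \<omega>) * of_bool (nc {0..<t} \<omega>))"
    by (simp add: LIMSEQ_const_iff)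
  also have "\<dots> = expectation (\<lambda>\<omega>. F (\<lambda>i. X i t \<omega>) * of_bool (nc {0..t} \<omega>))"
  proof (intro Bochner_Integration.integral_cong refl)
    fix \<omega>
    have "nc {0..t} \<omega> \<longleftrightarrow> nc {0..<t} \<omega> \<and> \<not> near n 0 (\<lambda>i. X i t \<omega>)"
      using t by (auto simp: no_collision_def order_le_less)
    then show "F (\<lambda>i. X i t \<omega>) * of_bool (nc {0..<t} \<omega>) = F (\<lambda>i. X i t \<omega>) * of_bool (nc {0..t} \<omega>)"
      using det_collision[of n "\<lambda>i. X i t \<omega>"] by (auto simp: F_def)
  qed
  finally show ?thesis .
qed

text \<open>The Markov property with an empty past: a single Gaussian step from
  \<open>a\<close>.\<close>

lemma expectation_F:
  assumes t: "0 < t"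
  shows "expectation (\<lambda>\<omega>. F (\<lambda>i. X i t \<omega>)) = smooth_det (sqrt (t * v)) a"
proof -
  have "strict_mono_on {..0::nat} (\<lambda>_. 0 :: real)" by (auto simp: strict_mono_on_def)
  then have "expectation (\<lambda>\<omega>. F (\<lambda>i. X i t \<omega>)) = expectation (\<lambda>\<omega>. smooth_det (sqrt (t * v)) (\<lambda>i. X i 0 \<omega>))"
    using markov(1)[of "\<lambda>_. 0" 0 t "\<lambda>_. 1"] t by simp
  also have "\<dots> = expectation (\<lambda>\<omega>. smooth_det (sqrt (t * v)) a)"
    unfolding smooth_det_def
    by (intro Bochner_Integration.integral_cong refl arg_cong[where f = Determinant.det])
      (auto intro!: eq_matI simp: X_0)
  finally show ?thesis by (simp add: prob_space)
qed

text \<open>The Karlin-McGregor formula in integrated form, with test functions in place of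
  densities.\<close>

lemma karlin_mcgregor:
  "0 < t \<Longrightarrow> expectation (\<lambda>\<omega>. F (\<lambda>i. X i t \<omega>) * of_bool (nc {0..t} \<omega>)) = smooth_det (sqrt (t * v)) a"
  using expectation_no_collision[of t] expectation_F[of t] by simp

end

text \<open>Exact for each admissible arc length, before any limit. Without a collision the
  particles are still in the alcove at time \<open>t\<close>, where \<open>det_arc_weight\<close>
  identifies \<open>F\<close> with the indicator of the arc condition.\<close>

lemma (in gaussian_increments) prob_arcs:
  fixes b :: "nat \<Rightarrow> real" and d t :: real
  defines "e \<equiv> (- 1) ^ (n - 1)"
  assumes t: "0 < t" and a: "alcove n a" and d: "0 < d" "d \<le> 2 * pi"
    and b: "\<And>i j. i < j \<Longrightarrow> j < n \<Longrightarrow> d \<le> b j - b i \<and> b j - b i \<le> 2 * pi - d"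
  shows "prob {\<omega> \<in> space M. no_collision n {0..t} (\<lambda>i s. X i s \<omega>) \<and>
      (\<forall>j<n. \<exists>!k. k < n \<and> cis (X k t \<omega>) \<in> cis ` {b j..<b j + d})} =
    Determinant.det (Matrix.mat n n (\<lambda>(i, j). \<integral>z. normal_density (a i) (sqrt (t * v)) z * arc_weight e (b j) d z \<partial>lborel))"
proof -
  interpret gaussian_increments_qp M n a X v "\<lambda>j. arc_weight e (b j) d" e
    by unfold_locales (auto simp: e_def abs_arc_weight_le arc_weight_shift)
  let ?S = "{\<omega> \<in> space M. nc {0..t} \<omega> \<and> (\<forall>j<n. \<exists>!k. k < n \<and> cis (X k t \<omega>) \<in> cis ` {b j..<b j + d})}"
  have eq: "F (\<lambda>i. X i t \<omega>) * of_bool (nc {0..t} \<omega>) = indicator ?S \<omega>" if \<omega>: "\<omega> \<in> space M" for \<omega>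
  proof (cases "nc {0..t} \<omega>")
    case True
    have "alcove n (\<lambda>i. X i t \<omega>)"
    proof (rule no_collision_alcove[OF _ _ True])
      show "continuous_on {0..t} (\<lambda>s. X i s \<omega>)" if "i < n" for i
        by (rule continuous_on_subset[OF X_continuous[OF that \<omega>]]) auto
      show "alcove n (\<lambda>i. X i 0 \<omega>)" using a \<omega> by (auto simp: alcove_def X_0)
    qed (use t in simp)
    from det_arc_weight[OF this d, of b] b show ?thesis
      using True \<omega> unfolding F_def unfolding e_def by simp
  qed simp
  \<comment> \<open>Read off from the identity just proved: the event is the level set at 1 of a
    measurable function.\<close>
  have meas: "?S \<in> sets M"
  proof -
    have [measurable]: "(\<lambda>\<omega>. F (\<lambda>i. X i t \<omega>) * of_bool (nc {0..t} \<omega>)) \<in> borel_measurable M"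
      using F_measurable[of t] nc_measurable[OF t] t by (auto intro!: borel_measurable_times)
    have "?S = {\<omega> \<in> space M. F (\<lambda>i. X i t \<omega>) * of_bool (nc {0..t} \<omega>) = 1}"
    proof (intro Collect_cong conj_cong refl)
      fix \<omega> assume "\<omega> \<in> space M"
      with eq[OF this] show "(nc {0..t} \<omega> \<and> (\<forall>j<n. \<exists>!k. k < n \<and> cis (X k t \<omega>) \<in> cis ` {b j..<b j + d})) =
         (F (\<lambda>i. X i t \<omega>) * of_bool (nc {0..t} \<omega>) = 1)"
        by (simp only:) (simp add: indicator_def)
    qed
    then show ?thesis by simp
  qed
  have "prob ?S = expectation (indicator ?S)" using meas by simp
  also have "\<dots> = expectation (\<lambda>\<omega>. F (\<lambda>i. X i t \<omega>) * of_bool (nc {0..t} \<omega>))"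
    by (intro Bochner_Integration.integral_cong refl) (simp add: eq)
  also have "\<dots> = smooth_det (sqrt (t * v)) a" by (rule karlin_mcgregor[OF t])
  finally show ?thesis by (simp add: smooth_det_def smooth_def)
qed

section \<open>Brownian particles\<close>

text \<open>Two kinds of independence are merged: between particles as random paths, and between the
  increments of one particle. A rectangle over all pairs is factored over particles, through the
  path events \<open>S k\<close>, and then over time steps.\<close>

lemma independent_increments:
  fixes \<tau> :: "nat \<Rightarrow> real"
  assumes ibm: "independent_brownian_motions M n B" and n: "n \<ge> 1"
    and \<tau>: "0 \<le> \<tau> 0" "strict_mono_on {..m} \<tau>"
  shows "prob_space.indep_vars M (\<lambda>_. borel) (\<lambda>(k, i) \<omega>. B k (\<tau> (Suc i)) \<omega> - B k (\<tau> i) \<omega>) ({..<n} \<times> {..<m})"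
proof -
  have sbm: "standard_brownian_motion M (B k)" if "k < n" for k
    using ibm that by (auto simp: independent_brownian_motions_def)
  interpret prob_space M using sbm[of 0] n by (auto simp: standard_brownian_motion_def)
  have "0 \<in> {..<n}" using n by simp
  then have ne: "{..<n} \<noteq> {}" by blast
  define P where "P k \<omega> = (\<lambda>s\<in>{0..}. B k s \<omega>)" for k \<omega>
  define D where "D = (\<lambda>(k, i) \<omega>. B k (\<tau> (Suc i)) \<omega> - B k (\<tau> i) \<omega>)"
  have paths: "indep_vars (\<lambda>_. PiM {0..} (\<lambda>_. borel)) P {..<n}"
    using ibm by (simp add: independent_brownian_motions_def P_def[abs_def])
  have B_meas: "B k s \<in> borel_measurable M" if "k < n" "0 \<le> s" for k s
    using sbm[OF that(1)] that(2) by (simp add: standard_brownian_motion_def)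
  have incr: "indep_vars (\<lambda>_. borel) (\<lambda>i. D (k, i)) {..<m}" if "k < n" for k
    using sbm[OF that] \<tau> by (simp add: standard_brownian_motion_def D_def)
  have \<tau>_nonneg: "0 \<le> \<tau> i" if "i \<le> m" for i
    using \<tau>(1) strict_mono_onD[OF \<tau>(2), of 0 i] that by (cases "i = 0") auto
  have "indep_vars (\<lambda>_. borel) D ({..<n} \<times> {..<m})"
  proof (cases "m = 0")
    case True
    then show ?thesis by (simp add: indep_vars_def indep_sets_def)
  next
    case False
    let ?I = "{..<n} \<times> {..<m}"
    have D_meas: "D x \<in> borel_measurable M" if "x \<in> ?I" for x
      using that \<tau>_nonneg B_meas by (cases x) (auto simp: D_def intro!: borel_measurable_diff)
    have "prob (\<Inter>x\<in>?I. D x -` A x \<inter> space M) = (\<Prod>x\<in>?I. prob (D x -` A x \<inter> space M))"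
      if A: "A \<in> (\<Pi> x\<in>?I. sets borel)" for A
    proof -
      define S where "S k = {p \<in> space (PiM {0..} (\<lambda>_. borel)). \<forall>i\<in>{..<m}. p (\<tau> (Suc i)) - p (\<tau> i) \<in> A (k, i)}" for k
      have S_meas: "S k \<in> sets (PiM {0..} (\<lambda>_. borel))" if "k < n" for k
        unfolding S_def
      proof (rule sets.sets_Collect_finite_All)
        fix i assume i: "i \<in> {..<m}"
        then have [measurable]: "A (k, i) \<in> sets borel" using A that by auto
        have [measurable]: "(\<lambda>p. p (\<tau> j)) \<in> borel_measurable (PiM {0..} (\<lambda>_. borel))" if "j \<le> m" for j
          using \<tau>_nonneg[OF that] by (intro measurable_component_singleton) auto
        have "Suc i \<le> m" "i \<le> m" using i by auto
        then show "{p \<in> space (PiM {0..} (\<lambda>_. borel)). p (\<tau> (Suc i)) - p (\<tau> i) \<in> A (k, i)} \<in> sets (PiM {0..} (\<lambda>_. borel))"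
          by measurable
      qed simp
      have P_space: "P k \<omega> \<in> space (PiM {0..} (\<lambda>_. borel))" for k \<omega>
        by (auto simp: P_def space_PiM)
      have S_iff: "P k -` S k \<inter> space M = (\<Inter>i\<in>{..<m}. D (k, i) -` A (k, i) \<inter> space M)" for k
        using False P_space \<tau>_nonneg by (auto simp: S_def P_def D_def)
      have "(\<Inter>x\<in>?I. D x -` A x \<inter> space M) = (\<Inter>k\<in>{..<n}. P k -` S k \<inter> space M)"
        unfolding S_iff by auto
      also have "prob \<dots> = (\<Prod>k\<in>{..<n}. prob (P k -` S k \<inter> space M))"
        using ne S_meas by (intro indep_varsD_finite[OF paths]) auto
      also have "\<dots> = (\<Prod>k\<in>{..<n}. \<Prod>i\<in>{..<m}. prob (D (k, i) -` A (k, i) \<inter> space M))"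
        unfolding S_iff using False A by (intro prod.cong refl indep_varsD_finite[OF incr]) auto
      also have "\<dots> = (\<Prod>x\<in>?I. prob (D x -` A x \<inter> space M))"
        by (simp add: prod.cartesian_product)
      finally show ?thesis .
    qed
    then show ?thesis
      using ne False D_meas
      by (subst indep_vars_finite[where E = "\<lambda>_. sets borel"])
        (auto simp: sets.Int_stable sets.sigma_sets_eq[of borel, simplified] intro!: sets.Int_stable)
  qed
  then show ?thesis by (simp add: D_def)
qed

text \<open>Brownian motion starts at 0 only almost surely, whereas \<open>X_0\<close> is demanded
  at every outcome; subtracting \<open>B k 0\<close> repairs this and changes no increment.\<close>

lemma gaussian_increments_brownian:
  assumes ibm: "independent_brownian_motions M n B" and n: "n \<ge> 1"
  shows "gaussian_increments M n a (\<lambda>k s \<omega>. a k + (B k s \<omega> - B k 0 \<omega>) / sqrt (real n)) (1 / real n)"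
proof -
  have sbm: "standard_brownian_motion M (B k)" if "k < n" for k
    using ibm that by (auto simp: independent_brownian_motions_def)
  interpret prob_space M using sbm[of 0] n by (auto simp: standard_brownian_motion_def)
  have B_meas [measurable]: "B k s \<in> borel_measurable M" if "k < n" "0 \<le> s" for k s
    using sbm[OF that(1)] that(2) by (simp add: standard_brownian_motion_def)
  show ?thesis
  proof unfold_locales
    show "0 < 1 / real n" using n by simp
    show "(\<lambda>\<omega>. a k + (B k s \<omega> - B k 0 \<omega>) / sqrt (real n)) \<in> borel_measurable M" if "k < n" "0 \<le> s" for k s
      using that by measurable
    show "continuous_on {0..} (\<lambda>s. a k + (B k s \<omega> - B k 0 \<omega>) / sqrt (real n))" if "k < n" "\<omega> \<in> space M" for k \<omega>
      using sbm[OF that(1)] that n by (intro continuous_intros) (auto simp: standard_brownian_motion_def)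
    show "a k + (B k 0 \<omega> - B k 0 \<omega>) / sqrt (real n) = a k" for k \<omega> by simp
    show "distributed M lborel (\<lambda>\<omega>. a k + (B k s \<omega> - B k 0 \<omega>) / sqrt (real n) - (a k + (B k r \<omega> - B k 0 \<omega>) / sqrt (real n)))
        (normal_density 0 (sqrt ((s - r) * (1 / real n))))" if "k < n" "0 \<le> r" "r < s" for k r s
    proof -
      have "distributed M lborel (\<lambda>\<omega>. B k s \<omega> - B k r \<omega>) (normal_density 0 (sqrt (s - r)))"
        using sbm[OF that(1)] that by (auto simp: standard_brownian_motion_def)
      from normal_density_affine[OF this, of "1 / sqrt (real n)" 0] show ?thesis
        using that n by (simp add: real_sqrt_divide[symmetric] diff_divide_distrib)
    qed
    show "indep_vars (\<lambda>_. borel) (\<lambda>(k, i) \<omega>. a k + (B k (\<tau> (Suc i)) \<omega> - B k 0 \<omega>) / sqrt (real n) -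
          (a k + (B k (\<tau> i) \<omega> - B k 0 \<omega>) / sqrt (real n))) ({..<n} \<times> {..<m})"
      if "0 \<le> \<tau> 0" "strict_mono_on {..m} \<tau>" for m and \<tau> :: "nat \<Rightarrow> real"
    proof -
      have "indep_vars (\<lambda>_. borel) (\<lambda>x \<omega>. (\<lambda>y. y / sqrt (real n)) ((case x of (k, i) \<Rightarrow> \<lambda>\<omega>. B k (\<tau> (Suc i)) \<omega> - B k (\<tau> i) \<omega>) \<omega>))
          ({..<n} \<times> {..<m})"
        by (rule indep_vars_compose2[OF independent_increments[OF ibm n that]]) measurable
      then show ?thesis by (simp add: case_prod_unfold diff_divide_distrib)
    qed
  qed
qed

lemma near_0_iff: "near n 0 x \<longleftrightarrow> (\<exists>i<n. \<exists>j<n. i \<noteq> j \<and> cis (x i) = cis (x j))"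
  unfolding near_def cis_eq_iff by (simp add: algebra_simps)

lemma nonintersecting_event_eq:
  "nonintersecting_event M n B a b t d = {\<omega> \<in> space M.
     no_collision n {0..t} (\<lambda>i s. a i + B i s \<omega> / sqrt (real n)) \<and>
     (\<forall>j<n. \<exists>!k. k < n \<and> cis (a k + B k t \<omega> / sqrt (real n)) \<in> cis ` {b j..<b j + d})}"
  unfolding nonintersecting_event_def particle_def no_collision_def near_0_iff by auto

text \<open>Unique existence becomes a finite combination of conditions on the Borel function
  \<open>arc_weight 1\<close>.\<close>

lemma sets_nonintersecting:
  assumes Y: "\<And>i s. i < n \<Longrightarrow> 0 \<le> s \<Longrightarrow> Y i s \<in> borel_measurable N"
    and cont: "\<And>i \<omega>. i < n \<Longrightarrow> \<omega> \<in> space N \<Longrightarrow> continuous_on {0..} (\<lambda>s. Y i s \<omega>)"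
    and t: "0 < t" and d: "d \<le> 2 * pi"
  shows "{\<omega> \<in> space N. no_collision n {0..t} (\<lambda>i s. Y i s \<omega>) \<and>
     (\<forall>j<n. \<exists>!k. k < n \<and> cis (Y k t \<omega>) \<in> cis ` {b j..<b j + d})} \<in> sets N"
proof -
  have [measurable]: "Measurable.pred N (\<lambda>\<omega>. no_collision n {0..t} (\<lambda>i s. Y i s \<omega>))"
    by (rule measurable_no_collision[OF Y cont t])
  have [measurable]: "Y k t \<in> borel_measurable N" if "k \<in> {..<n}" for k using Y t that by auto
  have "(\<forall>j<n. \<exists>!k. k < n \<and> cis (Y k t \<omega>) \<in> cis ` {b j..<b j + d}) \<longleftrightarrow>
      (\<forall>j\<in>{..<n}. \<exists>k\<in>{..<n}. arc_weight 1 (b j) d (Y k t \<omega>) \<noteq> 0 \<and>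
        (\<forall>l\<in>{..<n}. arc_weight 1 (b j) d (Y l t \<omega>) \<noteq> 0 \<longrightarrow> l = k))" for \<omega>
    using d by (simp add: cis_in_arc_iff[of 1] Ex1_def Ball_def Bex_def imp_conjL conj_assoc)
  then show ?thesis by simp
qed

theorem proposition1p1:
  fixes M :: "'w measure"
    and B :: "nat \<Rightarrow> real \<Rightarrow> 'w \<Rightarrow> real"
    and n :: nat and t :: real and a b :: "nat \<Rightarrow> real"
  assumes "n \<ge> 1" and "t > 0"
    and "independent_brownian_motions M n B"
    and "strict_mono_on {..<n} a" and "\<forall>k<n. - pi \<le> a k \<and> a k < pi"
    and "strict_mono_on {..<n} b" and "\<forall>k<n. - pi \<le> b k \<and> b k < pi"
  shows "(density_quotient M n B a b t \<longlongrightarrow> transition_density M n B a b t) (at_right 0)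
    \<and> complex_of_real (transition_density M n B a b t) =
        Determinant.det (Matrix.mat n n (\<lambda>(i, j). circle_kernel n (a i) (b j) t (parity_shift n)))"
proof -
  note n = \<open>n \<ge> 1\<close> and t = \<open>t > 0\<close> and ibm = \<open>independent_brownian_motions M n B\<close>
  define e :: real where "e = (- 1) ^ (n - 1)"
  define \<sigma> where "\<sigma> = sqrt (t / n)"
  define q where "q i j d = (\<integral>z. normal_density (a i) \<sigma> z * arc_weight e (b j) d z \<partial>lborel)" for i j d
  define K where "K i j = (\<Sum>\<^sub>\<infinity>k. e powi k * normal_density (a i) \<sigma> (b j + 2 * pi * of_int k))" for i j
  define X where "X k s \<omega> = a k + (B k s \<omega> - B k 0 \<omega>) / sqrt (real n)" for k s \<omega>
  define L where "L = Determinant.det (Matrix.mat n n (\<lambda>(i, j). K i j))"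
  have \<sigma>: "\<sigma> > 0" using n t by (simp add: \<sigma>_def)
  interpret gaussian_increments M n a X "1 / real n"
    using gaussian_increments_brownian[OF ibm n, of a] by (simp add: X_def[abs_def])
  have sbm: "standard_brownian_motion M (B k)" if "k < n" for k
    using ibm that by (auto simp: independent_brownian_motions_def)
  \<comment> \<open>Angles in one half-open period differ by less than
    \<open>2 * pi\<close>.\<close>
  have a: "alcove n a"
    unfolding alcove_def
  proof (intro allI impI)
    fix i j assume ij: "j < n" "i < j"
    then have "- pi \<le> a i" "a j < pi" "a i < a j"
      using assms(5) strict_mono_onD[OF assms(4), of i j] by auto
    then show "a i < a j \<and> a j < a i + 2 * pi" by linarith
  qed
  have quotient: "density_quotient M n B a b t d = Determinant.det (Matrix.mat n n (\<lambda>(i, j). q i j d / d))"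
    if d: "0 < d" "d \<le> 2 * pi" and b: "\<forall>j\<in>{..<n}. \<forall>i\<in>{..<j}. d \<le> b j - b i \<and> b j - b i \<le> 2 * pi - d" for d
  proof -
    let ?S = "{\<omega> \<in> space M. no_collision n {0..t} (\<lambda>i s. X i s \<omega>) \<and>
      (\<forall>j<n. \<exists>!k. k < n \<and> cis (X k t \<omega>) \<in> cis ` {b j..<b j + d})}"
    \<comment> \<open>Passing to the exact start changes the event only on the null set where some
      \<open>B k 0\<close> is nonzero.\<close>
    have "measure M (nonintersecting_event M n B a b t d) = measure M ?S"
    proof (rule measure_eq_AE)
      have "AE \<omega> in M. \<forall>k\<in>{..<n}. B k 0 \<omega> = 0"
        using sbm by (intro AE_finite_allI) (auto simp: standard_brownian_motion_def)
      then show "AE \<omega> in M. \<omega> \<in> nonintersecting_event M n B a b t d \<longleftrightarrow> \<omega> \<in> ?S"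
      proof (rule AE_mp, intro AE_I2 impI)
        fix \<omega> assume "\<omega> \<in> space M" and B0: "\<forall>k\<in>{..<n}. B k 0 \<omega> = 0"
        then have XB: "X k s \<omega> = a k + B k s \<omega> / sqrt (real n)" if "k < n" for k s
          using that by (simp add: X_def)
        have "no_collision n {0..t} (\<lambda>i s. X i s \<omega>) \<longleftrightarrow> no_collision n {0..t} (\<lambda>i s. a i + B i s \<omega> / sqrt (real n))"
          unfolding no_collision_def using XB by (intro ball_cong refl arg_cong[where f = Not] near_cong) auto
        then show "\<omega> \<in> nonintersecting_event M n B a b t d \<longleftrightarrow> \<omega> \<in> ?S"
          unfolding nonintersecting_event_eq by (simp add: XB cong: conj_cong)
      qed
      show "nonintersecting_event M n B a b t d \<in> sets M"
        unfolding nonintersecting_event_eq using sbm n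
        by (intro sets_nonintersecting t d)
          (auto simp: standard_brownian_motion_def intro!: continuous_intros borel_measurable_add borel_measurable_divide)
      show "?S \<in> sets M"
        by (intro sets_nonintersecting X_measurable X_continuous t d)
    qed
    also have "\<dots> = Determinant.det (Matrix.mat n n (\<lambda>(i, j). q i j d))"
      using prob_arcs[OF t a d, of b] b by (simp add: q_def \<sigma>_def e_def)
    \<comment> \<open>Every Leibniz term has \<open>n\<close> factors, so \<open>d ^ n\<close> gives
      one \<open>d\<close> to each entry.\<close>
    finally show ?thesis
      using d by (simp add: density_quotient_def det_mat_Leibniz sum_divide_distrib prod_dividef)
  qed
  have "\<forall>\<^sub>F d in at_right 0. d \<le> b j - b i \<and> b j - b i \<le> 2 * pi - d" if "i < j" "j < n" for i j
  proof -
    \<comment> \<open>For small \<open>d\<close> the arcs are disjoint on the circle, also across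
      the cut at \<pi>, because the spread of \<open>b\<close> is less than a period.\<close>
    have "- pi \<le> b i" "b j < pi" "b i < b j"
      using that assms(7) strict_mono_onD[OF assms(6), of i j] by auto
    then show ?thesis
      unfolding eventually_at_right_field
      by (intro exI[of _ "min (b j - b i) (2 * pi - (b j - b i))"]) auto
  qed
  then have "\<forall>\<^sub>F d in at_right 0. \<forall>j\<in>{..<n}. \<forall>i\<in>{..<j}. d \<le> b j - b i \<and> b j - b i \<le> 2 * pi - d"
    by (intro eventually_ball_finite ballI) auto
  moreover have "\<forall>\<^sub>F d in at_right 0. 0 < d \<and> d \<le> 2 * pi"
    unfolding eventually_at_right_field by (intro exI[of _ "2 * pi"]) auto
  ultimately have ev: "\<forall>\<^sub>F d in at_right 0.
      Determinant.det (Matrix.mat n n (\<lambda>(i, j). q i j d / d)) = density_quotient M n B a b t d"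
    by eventually_elim (simp add: quotient)
  have "((\<lambda>d. Determinant.det (Matrix.mat n n (\<lambda>(i, j). q i j d / d))) \<longlongrightarrow> L) (at_right 0)"
    unfolding det_mat_Leibniz L_def q_def K_def
    by (intro tendsto_sum tendsto_mult tendsto_const tendsto_prod tendsto_arc_weight_average[OF \<sigma>]) (simp add: e_def)
  then have lim: "(density_quotient M n B a b t \<longlongrightarrow> L) (at_right 0)"
    by (rule Lim_transform_eventually[OF _ ev])
  then have L: "transition_density M n B a b t = L"
    unfolding transition_density_def by (intro tendsto_Lim) auto
  have "complex_of_real L = Determinant.det (Matrix.mat n n (\<lambda>(i, j). circle_kernel n (a i) (b j) t (parity_shift n)))"
    unfolding L_def K_def e_def \<sigma>_def circle_kernel_eq[OF n t] det_mat_Leibniz by simp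
  then show ?thesis using lim L by simp
qed

end
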